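(* A positive NC measure $\mu$ is singular if and only if $\mathbb H^2_d(\mu+m)=\mathbb H^2_d(\mu)\oplus\mathbb H^2_d$, in the sense that the canonical isometry $\mathbb H^2_d(\mu+m)\to\mathbb H^2_d(\mu)\oplus\mathbb H^2_d$ determined by $a+N_{\mu+m}\mapsto(a+N_\mu)\oplus a1$, $a\in\mathcal A_d$, is onto.
   Context: Fix $d\in\mathbb N$. $\mathbb F^d$ is the free monoid of words in $1,\dots,d$. $\mathbb H^2_d=\ell^2(\mathbb F^d)$ has orthonormal basis $\{e_\alpha\}$, and $1:=e_\emptyset$. $L_ke_\alpha=e_{k\alpha}$ are the left free shifts. $\mathcal A_d$ is the norm-closed unital algebra generated by $L_1,\dots,L_d$; $a\in\mathcal A_d$ is identified with $a1\in\mathbb H^2_d$, so $\mathcal A_d$ is a dense subspace of $\mathbb H^2_d$. $\mathscr A_d$ is the norm closure of $\mathcal A_d+\mathcal A_d^*$; it contains $\mathcal A_d^*\mathcal A_d$. A positive NC measure is a positive linear functional on $\mathscr A_d$; NC Lebesgue measure is $m(a)=\langle1,a1\rangle$. Inner products and forms are conjugate-linear in the first argument. GNS space: $\mathbb H^2_d(\mu)$ is the Hilbert space completion of $\mathcal A_d/N_\mu$, $N_\mu=\{a\in\mathcal A_d:\mu(a^*a)=0\}$, for the inner product $\langle a_1+N_\mu,a_2+N_\mu\rangle_\mu=\mu(a_1^*a_2)$; in particular $\mathbb H^2_d(m)=\mathbb H^2_d$. Singularity: let $q_\mu(a_1,a_2)=\mu(a_1^*a_2)$, with domain $\mathcal A_d\subset\mathbb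 H^2_d$. A densely-defined positive semi-definite form $q$ is closable if $x_n\in\mathrm{Dom}\,q$, $x_n\to0$, $q(x_n-x_k,x_n-x_k)\to0$ imply $q(x_n,x_n)\to0$. The form order $q_1\le q_2$ means $\mathrm{Dom}\,q_2\subseteq\mathrm{Dom}\,q_1$ and $q_1(h,h)\le q_2(h,h)$ on $\mathrm{Dom}\,q_2$. By a theorem of B. Simon there is a maximal closable positive semi-definite form $(q_\mu)_{ac}\le q_\mu$ (with domain $\mathcal A_d$). $\mu$ is singular if $(q_\mu)_{ac}$ is identically zero. *)

theory Defs
  imports "HOL-Analysis.Analysis"
begin

section \<open>The Hilbert space of square-summable families\<close>

typedef 'a ell2 = "{f :: 'a \<Rightarrow> complex. (\<lambda>i. (cmod (f i))\<^sup>2) summable_on UNIV}"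
  morphisms ell2_coeff Abs_ell2
  by (rule exI[of _ "\<lambda>_. 0"]) simp

setup_lifting type_definition_ell2

lemma ell2_coeff_summable: "(\<lambda>i. (cmod (ell2_coeff x i))\<^sup>2) summable_on UNIV"
  using ell2_coeff[of x] by simp

lemma square_summable_product:
  fixes f g :: "'a \<Rightarrow> complex"
  assumes "(\<lambda>i. (cmod (f i))\<^sup>2) summable_on UNIV" "(\<lambda>i. (cmod (g i))\<^sup>2) summable_on UNIV"
  shows "(\<lambda>i. cnj (f i) * g i) summable_on UNIV"
proof -
  have "(\<lambda>i. norm (cnj (f i) * g i)) summable_on UNIV"
    by (rule abs_summable_product)
       (use assms in \<open>simp_all add: norm_mult power2_eq_square\<close>)
  then show ?thesis by (rule abs_summable_summable)
qed

lemma square_summable_add: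
  fixes f g :: "'a \<Rightarrow> complex"
  assumes "(\<lambda>i. (cmod (f i))\<^sup>2) summable_on UNIV" "(\<lambda>i. (cmod (g i))\<^sup>2) summable_on UNIV"
  shows "(\<lambda>i. (cmod (f i + g i))\<^sup>2) summable_on UNIV"
proof (rule summable_on_comparison_test)
  show "(\<lambda>i. 2 * (cmod (f i))\<^sup>2 + 2 * (cmod (g i))\<^sup>2) summable_on UNIV"
    using assms by (intro summable_on_add summable_on_cmult_right) auto
  fix i
  have "(cmod (f i + g i))\<^sup>2 \<le> (cmod (f i) + cmod (g i))\<^sup>2"
    by (intro power_mono norm_triangle_ineq) auto
  also have "\<dots> \<le> 2 * (cmod (f i))\<^sup>2 + 2 * (cmod (g i))\<^sup>2"
    using zero_le_power2[of "cmod (f i) - cmod (g i)"]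
    by (simp add: power2_sum power2_diff)
  finally show "(cmod (f i + g i))\<^sup>2 \<le> 2 * (cmod (f i))\<^sup>2 + 2 * (cmod (g i))\<^sup>2" .
qed auto

lemma square_summable_scale:
  fixes f :: "'a \<Rightarrow> complex"
  assumes "(\<lambda>i. (cmod (f i))\<^sup>2) summable_on UNIV"
  shows "(\<lambda>i. (cmod (c * f i))\<^sup>2) summable_on UNIV"
  using assms by (simp add: norm_mult power_mult_distrib summable_on_cmult_right)

lift_definition cinner :: "'a ell2 \<Rightarrow> 'a ell2 \<Rightarrow> complex"
  is "\<lambda>f g. \<Sum>\<^sub>\<infinity>i. cnj (f i) * g i" .

lift_definition scaleC :: "complex \<Rightarrow> 'a ell2 \<Rightarrow> 'a ell2"  (infixr \<open>*\<^sub>C\<close> 75)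
  is "\<lambda>c f i. c * f i"
  by (simp add: square_summable_scale)

instantiation ell2 :: (type) real_inner
begin

lift_definition zero_ell2 :: "'a ell2" is "\<lambda>_. 0" by simp

lift_definition plus_ell2 :: "'a ell2 \<Rightarrow> 'a ell2 \<Rightarrow> 'a ell2" is "\<lambda>f g i. f i + g i"
  by (simp add: square_summable_add)

lift_definition uminus_ell2 :: "'a ell2 \<Rightarrow> 'a ell2" is "\<lambda>f i. - f i" by simp

lift_definition minus_ell2 :: "'a ell2 \<Rightarrow> 'a ell2 \<Rightarrow> 'a ell2" is "\<lambda>f g i. f i - g i"
proof -
  fix f g :: "'a \<Rightarrow> complex"
  assume "(\<lambda>i. (cmod (f i))\<^sup>2) summable_on UNIV"
    "(\<lambda>i. (cmod (g i))\<^sup>2) summable_on UNIV"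
  then show "(\<lambda>i. (cmod (f i - g i))\<^sup>2) summable_on UNIV"
    using square_summable_add[of f "\<lambda>i. - g i"] by simp
qed

definition scaleR_ell2 :: "real \<Rightarrow> 'a ell2 \<Rightarrow> 'a ell2"
  where "scaleR_ell2 r x = complex_of_real r *\<^sub>C x"

definition inner_ell2 :: "'a ell2 \<Rightarrow> 'a ell2 \<Rightarrow> real"
  where "inner_ell2 x y = Re (cinner x y)"

definition norm_ell2 :: "'a ell2 \<Rightarrow> real"
  where "norm_ell2 x = sqrt (inner x x)"

definition sgn_ell2 :: "'a ell2 \<Rightarrow> 'a ell2"
  where "sgn_ell2 x = inverse (norm x) *\<^sub>R x"

definition dist_ell2 :: "'a ell2 \<Rightarrow> 'a ell2 \<Rightarrow> real"
  where "dist_ell2 x y = norm (x - y)"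

definition uniformity_ell2 :: "('a ell2 \<times> 'a ell2) filter"
  where "uniformity_ell2 = (INF e\<in>{0<..}. principal {(x, y). dist x y < e})"

definition open_ell2 :: "'a ell2 set \<Rightarrow> bool"
  where "open_ell2 U \<longleftrightarrow> (\<forall>x\<in>U. eventually (\<lambda>(x', y). x' = x \<longrightarrow> y \<in> U) uniformity)"

lemma inner_ell2_self: "inner x x = (\<Sum>\<^sub>\<infinity>i. (cmod (ell2_coeff x i))\<^sup>2)" for x :: "'a ell2"
proof -
  have "inner x x = (\<Sum>\<^sub>\<infinity>i. Re (cnj (ell2_coeff x i) * ell2_coeff x i))"
    unfolding inner_ell2_def cinner.rep_eq
    by (rule infsum_Re[symmetric]) (intro square_summable_product ell2_coeff_summable)
  also have "\<dots> = (\<Sum>\<^sub>\<infinity>i. (cmod (ell2_coeff x i))\<^sup>2)"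
    by (intro infsum_cong) (simp add: cmod_power2 flip: power2_eq_square)
  finally show ?thesis .
qed

instance
proof
  fix x y z :: "'a ell2" and r s :: real
  show "x + y + z = x + (y + z)" by transfer (simp add: add.assoc)
  show "x + y = y + x" by transfer (simp add: add.commute)
  show "0 + x = x" by transfer simp
  show "- x + x = 0" by transfer simp
  show "x - y = x + - y" by transfer simp
  show "r *\<^sub>R (x + y) = r *\<^sub>R x + r *\<^sub>R y"
    unfolding scaleR_ell2_def by transfer (simp add: distrib_left)
  show "(r + s) *\<^sub>R x = r *\<^sub>R x + s *\<^sub>R x"
    unfolding scaleR_ell2_def by transfer (simp add: distrib_right)
  show "r *\<^sub>R s *\<^sub>R x = (r * s) *\<^sub>R x"
    unfolding scaleR_ell2_def by transfer (simp add: mult.assoc)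
  show "1 *\<^sub>R x = x"
    unfolding scaleR_ell2_def by transfer simp
  show "sgn x = inverse (norm x) *\<^sub>R x" by (rule sgn_ell2_def)
  show "dist x y = norm (x - y)" by (rule dist_ell2_def)
  show "uniformity = (INF e\<in>{0<..}. principal {(x, y :: 'a ell2). dist x y < e})"
    by (rule uniformity_ell2_def)
  show "open U \<longleftrightarrow> (\<forall>x\<in>U. eventually (\<lambda>(x', y). x' = x \<longrightarrow> y \<in> U) uniformity)"
    for U :: "'a ell2 set"
    by (rule open_ell2_def)
  show "norm x = sqrt (inner x x)" by (rule norm_ell2_def)
  have "cinner x y = cnj (cinner y x)"
    unfolding cinner.rep_eq by (simp flip: infsum_cnj add: mult.commute)
  then show "inner x y = inner y x" by (simp add: inner_ell2_def)
  have "cinner (x + y) z = cinner x z + cinner y z"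
    unfolding cinner.rep_eq plus_ell2.rep_eq
    by (simp add: distrib_right infsum_add square_summable_product ell2_coeff_summable)
  then show "inner (x + y) z = inner x z + inner y z" by (simp add: inner_ell2_def)
  have "cinner (r *\<^sub>R x) y = r * cinner x y"
    unfolding cinner.rep_eq scaleR_ell2_def scaleC.rep_eq
    by (simp add: mult.assoc infsum_cmult_right square_summable_product ell2_coeff_summable)
  then show "inner (r *\<^sub>R x) y = r * inner x y" by (simp add: inner_ell2_def)
  show "0 \<le> inner x x" unfolding inner_ell2_self by (intro infsum_nonneg) auto
  show "inner x x = 0 \<longleftrightarrow> x = 0"
  proof
    assume "inner x x = 0"
    then have "(\<Sum>\<^sub>\<infinity>i. (cmod (ell2_coeff x i))\<^sup>2) \<le> 0" by (simp add: inner_ell2_self)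
    then have "(cmod (ell2_coeff x i))\<^sup>2 = 0" for i
      by (rule nonneg_infsum_le_0D) (auto simp: ell2_coeff_summable)
    then show "x = 0" by (simp add: fun_eq_iff zero_ell2.rep_eq flip: ell2_coeff_inject)
  qed (simp add: inner_ell2_self zero_ell2.rep_eq)
qed

end

lift_definition ell2_basis :: "'a \<Rightarrow> 'a ell2" is "\<lambda>a i. if i = a then 1 else 0"
proof -
  fix a :: 'a
  have "(\<lambda>i. (cmod (if i = a then 1 else 0))\<^sup>2) summable_on {a}" by simp
  then have "(\<lambda>i. (cmod (if i = a then 1 else 0))\<^sup>2) summable_on UNIV"
    by (rule summable_on_cong_neutral[THEN iffD1, rotated -1]) auto
  then show "(\<lambda>i. (cmod (if i = a then 1 else 0))\<^sup>2) summable_on UNIV" .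
qed

lemma norm_scaleC: "norm (c *\<^sub>C x) = cmod c * norm x"
proof -
  have "inner (c *\<^sub>C x) (c *\<^sub>C x) = (cmod c)\<^sup>2 * inner x x"
    unfolding inner_ell2_self scaleC.rep_eq
    by (simp add: norm_mult power_mult_distrib infsum_cmult_right ell2_coeff_summable)
  then show ?thesis by (simp add: norm_eq_sqrt_inner real_sqrt_mult)
qed

lemma bounded_linear_scaleC: "bounded_linear (scaleC c)"
proof (rule bounded_linear_intro[where K = "cmod c"])
  show "c *\<^sub>C (x + y) = c *\<^sub>C x + c *\<^sub>C y" for x y :: "'a ell2"
    by transfer (simp add: distrib_left)
  show "c *\<^sub>C (r *\<^sub>R x) = r *\<^sub>R (c *\<^sub>C x)" for r and x :: "'a ell2"
    unfolding scaleR_ell2_def by transfer (simp add: mult.left_commute)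
qed (simp add: norm_scaleC mult.commute)


section \<open>Operators\<close>

text \<open>
  Bounded operators are modelled by real-linear ones, so that the library's operator norm and norm
  topology apply. All operators occurring below are complex-linear, because the generating
  shifts are and complex-linearity is preserved by sums, products, complex multiples, adjoints and
  norm limits.
\<close>

type_synonym 'a op = "'a ell2 \<Rightarrow>\<^sub>L 'a ell2"

definition op_scaleC :: "complex \<Rightarrow> 'a op \<Rightarrow> 'a op"
  where "op_scaleC c A = Blinfun (\<lambda>x. c *\<^sub>C A x)"

lemma op_scaleC_apply: "op_scaleC c A x = c *\<^sub>C A x"
  unfolding op_scaleC_def
  by (simp add: bounded_linear_Blinfun_apply
      bounded_linear_compose[OF bounded_linear_scaleC blinfun.bounded_linear_right])

definition adj :: "'a op \<Rightarrow> 'a op"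
  where "adj A = (THE B :: 'a op. \<forall>x y. cinner (A x) y = cinner x (B y))"

definition positive_op :: "'a op \<Rightarrow> bool"
  where "positive_op A \<longleftrightarrow> (\<forall>x. cinner x (A x) \<in> \<real>\<^sub>\<ge>\<^sub>0)"

definition op_subalgebra :: "'a op set \<Rightarrow> bool" where
  "op_subalgebra S \<longleftrightarrow> id_blinfun \<in> S \<and>
     (\<forall>A\<in>S. \<forall>B\<in>S. A + B \<in> S \<and> A o\<^sub>L B \<in> S) \<and> (\<forall>c. \<forall>A\<in>S. op_scaleC c A \<in> S)"


section \<open>The free disk algebra and positive noncommutative measures\<close>

text \<open>
  The letters are the elements of a finite type \<open>'d\<close>, so \<open>d = CARD('d) \<ge> 1\<close> is arbitrary;
  \<open>'d list\<close> is the free monoid.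
\<close>

abbreviation vac :: "'d list ell2" where "vac \<equiv> ell2_basis []"

lift_definition shift_vec :: "'d \<Rightarrow> 'd list ell2 \<Rightarrow> 'd list ell2"
  is "\<lambda>k f w. case w of [] \<Rightarrow> 0 | j # v \<Rightarrow> if j = k then f v else 0"
proof -
  fix k :: 'd and f :: "'d list \<Rightarrow> complex"
  let ?g = "\<lambda>w. case w of [] \<Rightarrow> 0 | j # v \<Rightarrow> if j = k then f v else 0"
  assume "(\<lambda>i. (cmod (f i))\<^sup>2) summable_on UNIV"
  then have "((\<lambda>w. (cmod (?g w))\<^sup>2) \<circ> (#) k) summable_on UNIV" by (simp add: o_def)
  then have "(\<lambda>w. (cmod (?g w))\<^sup>2) summable_on range ((#) k)"
    by (subst summable_on_reindex) auto
  then have "(\<lambda>w. (cmod (?g w))\<^sup>2) summable_on UNIV"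
    by (rule summable_on_cong_neutral[THEN iffD1, rotated -1]) (auto split: list.splits)
  then show "(\<lambda>w. (cmod (?g w))\<^sup>2) summable_on UNIV" .
qed

lemma norm_shift_vec: "norm (shift_vec k x) = norm x"
proof -
  let ?h = "\<lambda>w. (cmod (ell2_coeff (shift_vec k x) w))\<^sup>2"
  have "inner (shift_vec k x) (shift_vec k x) = infsum ?h (range ((#) k))"
    unfolding inner_ell2_self
    by (rule infsum_cong_neutral) (auto simp: shift_vec.rep_eq split: list.splits)
  also have "\<dots> = infsum (?h \<circ> (#) k) UNIV" by (rule infsum_reindex) simp
  also have "\<dots> = inner x x" unfolding inner_ell2_self by (simp add: o_def shift_vec.rep_eq)
  finally show ?thesis by (simp add: norm_eq_sqrt_inner)
qed

definition left_shift :: "'d \<Rightarrow> 'd list op"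
  where "left_shift k = Blinfun (shift_vec k)"

lemma bounded_linear_shift_vec: "bounded_linear (shift_vec k)"
proof (rule bounded_linear_intro[where K = 1])
  show "shift_vec k (x + y) = shift_vec k x + shift_vec k y" for x y
    by transfer (auto simp: fun_eq_iff split: list.splits)
  show "shift_vec k (r *\<^sub>R x) = r *\<^sub>R shift_vec k x" for r x
    unfolding scaleR_ell2_def by transfer (auto simp: fun_eq_iff split: list.splits)
qed (simp add: norm_shift_vec)

lemma left_shift_basis: "left_shift k (ell2_basis w) = ell2_basis (k # w)"
proof -
  have "shift_vec k (ell2_basis w) = ell2_basis (k # w)"
    by transfer (auto simp: fun_eq_iff split: list.splits)
  then show ?thesis
    by (simp add: left_shift_def bounded_linear_Blinfun_apply bounded_linear_shift_vec)
qed

definition disk_algebra :: "'d::finite list op set"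
  where "disk_algebra = \<Inter>{S. op_subalgebra S \<and> closed S \<and> range left_shift \<subseteq> S}"

definition disk_system :: "'d::finite list op set"
  where "disk_system = closure {a + adj b | a b. a \<in> disk_algebra \<and> b \<in> disk_algebra}"

text \<open>A functional is a total function of which only the values on \<^const>\<open>disk_system\<close> matter.\<close>

definition nc_measure :: "('d::finite list op \<Rightarrow> complex) \<Rightarrow> bool" where
  "nc_measure \<mu> \<longleftrightarrow>
     (\<forall>a\<in>disk_system. \<forall>b\<in>disk_system. \<mu> (a + b) = \<mu> a + \<mu> b) \<and>
     (\<forall>c. \<forall>a\<in>disk_system. \<mu> (op_scaleC c a) = c * \<mu> a) \<and>
     (\<forall>a\<in>disk_system. positive_op a \<longrightarrow> \<mu> a \<in> \<real>\<^sub>\<ge>\<^sub>0)"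

definition nc_lebesgue :: "'d::finite list op \<Rightarrow> complex"
  where "nc_lebesgue a = cinner vac (a vac)"


section \<open>The GNS space\<close>

definition gns_form :: "('d::finite list op \<Rightarrow> complex) \<Rightarrow> 'd list op \<Rightarrow> 'd list op \<Rightarrow> complex"
  where "gns_form \<mu> a b = \<mu> (adj a o\<^sub>L b)"

definition gns_seminorm :: "('d::finite list op \<Rightarrow> complex) \<Rightarrow> 'd list op \<Rightarrow> real"
  where "gns_seminorm \<mu> a = sqrt (Re (gns_form \<mu> a a))"

text \<open>
  The Hilbert space completion of the quotient of the disk algebra by the null space of the
  seminorm: Cauchy sequences of representatives modulo sequences tending to zero in seminorm, which
  performs the quotient and the completion in one step. The class of the constant sequence \<open>a\<close> is
  the image of the coset of \<open>a\<close>.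
\<close>

definition gns_cauchy :: "('d::finite list op \<Rightarrow> complex) \<Rightarrow> (nat \<Rightarrow> 'd list op) set" where
  "gns_cauchy \<mu> = {X. (\<forall>n. X n \<in> disk_algebra) \<and>
     (\<forall>e>0. \<exists>N. \<forall>n\<ge>N. \<forall>k\<ge>N. gns_seminorm \<mu> (X n - X k) < e)}"

definition gns_rel ::
    "('d::finite list op \<Rightarrow> complex) \<Rightarrow> ((nat \<Rightarrow> 'd list op) \<times> (nat \<Rightarrow> 'd list op)) set" where
  "gns_rel \<mu> = {(X, Y). X \<in> gns_cauchy \<mu> \<and> Y \<in> gns_cauchy \<mu> \<and>
     (\<lambda>n. gns_seminorm \<mu> (X n - Y n)) \<longlonglongrightarrow> 0}"

type_synonym 'd gns = "(nat \<Rightarrow> 'd list op) set"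

definition gns_space :: "('d::finite list op \<Rightarrow> complex) \<Rightarrow> 'd gns set"
  where "gns_space \<mu> = gns_cauchy \<mu> // gns_rel \<mu>"

definition gns_embed :: "('d::finite list op \<Rightarrow> complex) \<Rightarrow> 'd list op \<Rightarrow> 'd gns"
  where "gns_embed \<mu> a = gns_rel \<mu> `` {\<lambda>_. a}"

definition gns_add :: "('d::finite list op \<Rightarrow> complex) \<Rightarrow> 'd gns \<Rightarrow> 'd gns \<Rightarrow> 'd gns"
  where "gns_add \<mu> C D = (\<Union>X\<in>C. \<Union>Y\<in>D. gns_rel \<mu> `` {\<lambda>n. X n + Y n})"

definition gns_scale :: "('d::finite list op \<Rightarrow> complex) \<Rightarrow> complex \<Rightarrow> 'd gns \<Rightarrow> 'd gns"
  where "gns_scale \<mu> c C = (\<Union>X\<in>C. gns_rel \<mu> `` {\<lambda>n. op_scaleC c (X n)})"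

definition gns_inner :: "('d::finite list op \<Rightarrow> complex) \<Rightarrow> 'd gns \<Rightarrow> 'd gns \<Rightarrow> complex" where
  "gns_inner \<mu> C D = (THE z. \<forall>X\<in>C. \<forall>Y\<in>D. (\<lambda>n. gns_form \<mu> (X n) (Y n)) \<longlonglongrightarrow> z)"

text \<open>
  The linear isometry of the GNS space of \<open>\<mu> + m\<close> into the Hilbert space direct sum of that of
  \<open>\<mu>\<close> and the Fock space with prescribed values on the (dense) image of the disk algebra. On the
  GNS space it is unique.
\<close>

definition gns_canonical_isometry ::
    "('d::finite list op \<Rightarrow> complex) \<Rightarrow> ('d gns \<Rightarrow> 'd gns \<times> 'd list ell2) \<Rightarrow> bool" where
  "gns_canonical_isometry \<mu> V \<longleftrightarrow>
     (let \<nu> = (\<lambda>a. \<mu> a + nc_lebesgue a); H = gns_space \<nu> in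
      V ` H \<subseteq> gns_space \<mu> \<times> UNIV \<and>
      (\<forall>C\<in>H. \<forall>D\<in>H. V (gns_add \<nu> C D) =
         (gns_add \<mu> (fst (V C)) (fst (V D)), snd (V C) + snd (V D))) \<and>
      (\<forall>c. \<forall>C\<in>H. V (gns_scale \<nu> c C) = (gns_scale \<mu> c (fst (V C)), c *\<^sub>C snd (V C))) \<and>
      (\<forall>C\<in>H. \<forall>D\<in>H. gns_inner \<mu> (fst (V C)) (fst (V D)) + cinner (snd (V C)) (snd (V D)) =
         gns_inner \<nu> C D) \<and>
      (\<forall>a\<in>disk_algebra. V (gns_embed \<nu> a) = (gns_embed \<mu> a, a vac)))"


section \<open>Forms and singularity\<close>

text \<open>A form is given by its domain and a function of which only the values on the domain matter.\<close>

type_synonym 'a form = "'a ell2 set \<times> ('a ell2 \<Rightarrow> 'a ell2 \<Rightarrow> complex)"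

definition psd_form :: "'a form \<Rightarrow> bool" where
  "psd_form = (\<lambda>(D, q).
     0 \<in> D \<and> (\<forall>x\<in>D. \<forall>y\<in>D. x + y \<in> D) \<and> (\<forall>c. \<forall>x\<in>D. c *\<^sub>C x \<in> D) \<and> closure D = UNIV \<and>
     (\<forall>x\<in>D. \<forall>y\<in>D. \<forall>z\<in>D. q (x + y) z = q x z + q y z \<and> q z (x + y) = q z x + q z y) \<and>
     (\<forall>c. \<forall>x\<in>D. \<forall>y\<in>D. q (c *\<^sub>C x) y = cnj c * q x y \<and> q x (c *\<^sub>C y) = c * q x y) \<and>
     (\<forall>x\<in>D. q x x \<in> \<real>\<^sub>\<ge>\<^sub>0))"

definition closable_form :: "'a form \<Rightarrow> bool" where
  "closable_form = (\<lambda>(D, q). \<forall>x :: nat \<Rightarrow> 'a ell2.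
     (\<forall>n. x n \<in> D) \<and> x \<longlonglongrightarrow> 0 \<and>
     (\<forall>e>0. \<exists>N. \<forall>n\<ge>N. \<forall>k\<ge>N. cmod (q (x n - x k) (x n - x k)) < e) \<longrightarrow>
     (\<lambda>n. q (x n) (x n)) \<longlonglongrightarrow> 0)"

definition form_le :: "'a form \<Rightarrow> 'a form \<Rightarrow> bool" where
  "form_le = (\<lambda>(D1, q1) (D2, q2). D2 \<subseteq> D1 \<and> (\<forall>h\<in>D2. Re (q1 h h) \<le> Re (q2 h h)))"

text \<open>
  The maximal closable form below \<open>q\<close>, i.e.\ the greatest one in the form order. On its domain it
  is unique, by polarization.
\<close>

definition is_form_ac :: "'a form \<Rightarrow> 'a form \<Rightarrow> bool" where
  "is_form_ac q p \<longleftrightarrow> psd_form p \<and> closable_form p \<and> form_le p q \<and> fst p = fst q \<and>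
     (\<forall>r. psd_form r \<and> closable_form r \<and> form_le r q \<longrightarrow> form_le r p)"

text \<open>
  The disk algebra is identified with a subspace of the Fock space along the injective map
  \<open>a \<mapsto> a 1\<close>; \<open>vec_op\<close> is its inverse.
\<close>

definition disk_vecs :: "'d::finite list ell2 set"
  where "disk_vecs = (\<lambda>a :: 'd list op. a vac) ` disk_algebra"

definition vec_op :: "'d::finite list ell2 \<Rightarrow> 'd list op"
  where "vec_op = the_inv_into disk_algebra (\<lambda>a. a vac)"

definition nc_form :: "('d::finite list op \<Rightarrow> complex) \<Rightarrow> 'd list form"
  where "nc_form \<mu> = (disk_vecs, \<lambda>x y. gns_form \<mu> (vec_op x) (vec_op y))"

definition nc_singular :: "('d::finite list op \<Rightarrow> complex) \<Rightarrow> bool" where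
  "nc_singular \<mu> \<longleftrightarrow> (\<exists>p. is_form_ac (nc_form \<mu>) p \<and> (\<forall>x\<in>fst p. \<forall>y\<in>fst p. snd p x y = 0))"

end

theory Submission
  imports Defs
begin

text \<open>
  The canonical isometry maps onto a closed subspace, the closure of the pairs \<open>(a, a 1)\<close>. So it is
  onto iff these pairs are dense, that is, iff every \<open>a\<close> in the disk algebra is approximated in the
  seminorm of \<open>\<mu>\<close> by elements whose vectors are small in the Fock space
  (\<open>canonical_map_onto\<close>, \<open>vanishing_approximation_if_onto\<close>). Singularity, on the other hand, says that
  every closable form below that of \<open>\<mu>\<close> vanishes on the vectors \<open>a 1\<close> (\<open>nc_singular_iff\<close>).

  Suppose that the approximation property holds and that \<open>r\<close> is closable and below the form of \<open>\<mu>\<close>.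
  Let \<open>y n\<close> approximate \<open>a\<close> with vectors tending to zero. Then \<open>r\<close> is Cauchy along \<open>y n\<close>, so it
  tends to zero there by closability, and it also tends to its value at \<open>a\<close>
  (\<open>singular_if_vanishing_approximation\<close>).

  Conversely, the obstruction to approximating \<open>(a, 0)\<close> is its component orthogonal to all pairs,
  which is found by minimizing the distance. Its Fock space part \<open>v\<close> is a functional bounded both
  in the norm of the Fock space and in the seminorm of \<open>\<mu>\<close>. A multiple of the rank-one form
  of \<open>v\<close> therefore is closable and below the form of \<open>\<mu>\<close>, so \<open>v = 0\<close> for singular \<open>\<mu>\<close>
  (\<open>singular_imp_dominated_vector_zero\<close>), and then the obstruction vanishes altogether
  (\<open>vanishing_approximation_if_singular\<close>).

  The form of \<open>\<mu>\<close> is positive and sesquilinear because products of adjoints with elements of the disk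
  algebra lie in the disk system (\<open>adj_comp_disk_system\<close>). It lives on vectors because the
  vacuum separates the algebra (\<open>disk_algebra_separating\<close>), which commutes with the right shifts.
\<close>

section \<open>Square-summable families as a complex Hilbert space\<close>

lemma cinner_cnj: "cinner y x = cnj (cinner x y)"
  unfolding cinner.rep_eq by (simp flip: infsum_cnj add: mult.commute)

lemma cinner_add_left: "cinner (x + y) z = cinner x z + cinner y z"
  unfolding cinner.rep_eq plus_ell2.rep_eq
  by (simp add: distrib_right infsum_add square_summable_product ell2_coeff_summable)

lemma cinner_scaleC_right: "cinner x (c *\<^sub>C y) = c * cinner x y"
  unfolding cinner.rep_eq scaleC.rep_eq
  by (simp add: mult.left_commute infsum_cmult_right square_summable_product ell2_coeff_summable)

lemma cinner_add_right: "cinner z (x + y) = cinner z x + cinner z y"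
  by (metis cinner_add_left cinner_cnj complex_cnj_add)

lemma cinner_scaleC_left: "cinner (c *\<^sub>C x) y = cnj c * cinner x y"
  by (metis cinner_scaleC_right cinner_cnj complex_cnj_mult)

lemma scaleC_minus_one: "(-1) *\<^sub>C x = - x"
  by transfer simp

lemma scaleC_scaleC: "c *\<^sub>C d *\<^sub>C x = (c * d) *\<^sub>C x"
  by transfer (simp add: mult.assoc)

lemma scaleC_one: "1 *\<^sub>C x = x"
  by transfer simp

lemma scaleC_zero: "0 *\<^sub>C x = 0"
  by transfer simp

lemma scaleC_add_right: "c *\<^sub>C (x + y) = c *\<^sub>C x + c *\<^sub>C y"
  by transfer (simp add: distrib_left)

lemma cinner_minus_right: "cinner z (- x) = - cinner z x"
  by (metis cinner_scaleC_right scaleC_minus_one mult_minus1)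

lemma cinner_minus_left: "cinner (- x) z = - cinner x z"
  by (metis cinner_minus_right cinner_cnj complex_cnj_minus)

lemma cinner_diff_right: "cinner z (x - y) = cinner z x - cinner z y"
  by (metis cinner_add_right cinner_minus_right diff_conv_add_uminus)

lemma cinner_diff_left: "cinner (x - y) z = cinner x z - cinner y z"
  by (metis cinner_add_left cinner_minus_left diff_conv_add_uminus)

lemma cinner_zero_right [simp]: "cinner x 0 = 0"
  using cinner_diff_right[of x 0 0] by simp

lemma cinner_zero_left [simp]: "cinner 0 x = 0"
  using cinner_diff_left[of 0 0 x] by simp

lemma cinner_self: "cinner x x = complex_of_real ((norm x)\<^sup>2)"
proof (rule complex_eqI)
  show "Re (cinner x x) = Re (complex_of_real ((norm x)\<^sup>2))"
    by (simp add: power2_norm_eq_inner inner_ell2_def)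
  have "cinner x x = cnj (cinner x x)" by (rule cinner_cnj)
  then show "Im (cinner x x) = Im (complex_of_real ((norm x)\<^sup>2))"
    by (simp add: complex_eq_iff)
qed

text \<open>
  Rotating the second argument by a phase makes the inner product real, so the complex inequality
  follows from the real one.
\<close>
lemma cinner_norm_le: "cmod (cinner x y) \<le> norm x * norm y"
proof -
  define u where "u = cnj (sgn (cinner x y))"
  have "cinner x (u *\<^sub>C y) = of_real (cmod (cinner x y))"
    unfolding cinner_scaleC_right u_def
    by (cases "cinner x y = 0")
       (simp_all add: sgn_eq field_simps complex_norm_square[symmetric] power2_eq_square
         del: of_real_mult flip: of_real_mult)
  then have "cmod (cinner x y) = inner x (u *\<^sub>C y)" by (simp add: inner_ell2_def)
  also have "\<dots> \<le> norm x * norm (u *\<^sub>C y)" by (rule norm_cauchy_schwarz)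
  also have "\<dots> \<le> norm x * norm y"
    by (simp add: norm_scaleC u_def norm_sgn mult_left_mono)
  finally show ?thesis .
qed

lemma bounded_bilinear_cinner: "bounded_bilinear cinner"
proof
  show "cinner (r *\<^sub>R x) y = r *\<^sub>R cinner x y" for r and x y :: "'a ell2"
    by (simp add: scaleR_ell2_def cinner_scaleC_left scaleR_conv_of_real)
  show "cinner x (r *\<^sub>R y) = r *\<^sub>R cinner x y" for r and x y :: "'a ell2"
    by (simp add: scaleR_ell2_def cinner_scaleC_right scaleR_conv_of_real)
  show "\<exists>K. \<forall>(x :: 'a ell2) y. norm (cinner x y) \<le> norm x * norm y * K"
    by (rule exI[of _ 1]) (simp add: cinner_norm_le)
qed (rule cinner_add_left cinner_add_right)+

lemmas tendsto_cinner [tendsto_intros] = bounded_bilinear.tendsto[OF bounded_bilinear_cinner]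
lemmas tendsto_scaleC [tendsto_intros] = bounded_linear.tendsto[OF bounded_linear_scaleC]

lemma cinner_eqI:
  assumes "\<And>z. cinner z x = cinner z y"
  shows "x = y"
proof -
  have "cinner (x - y) (x - y) = 0" using assms by (simp add: cinner_diff_right)
  then show ?thesis by (simp add: cinner_self)
qed

lemma cinner_basis: "cinner (ell2_basis w) x = ell2_coeff x w"
proof -
  have "cinner (ell2_basis w) x = infsum (\<lambda>i. cnj (ell2_coeff (ell2_basis w) i) * ell2_coeff x i) {w}"
    unfolding cinner.rep_eq
    by (rule infsum_cong_neutral) (auto simp: ell2_basis.rep_eq)
  then show ?thesis by (simp add: ell2_basis.rep_eq)
qed

lemma norm_ell2_basis: "norm (ell2_basis w) = 1"
proof -
  have "(complex_of_real ((norm (ell2_basis w :: 'a ell2))\<^sup>2)) = 1"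
    unfolding cinner_self[symmetric] cinner_basis by (simp add: ell2_basis.rep_eq)
  then show ?thesis
    by (metis norm_ge_zero of_real_eq_1_iff power2_eq_1_iff one_neq_neg_one 
     not_one_le_zero neg_0_le_iff_le)
qed

lemma power2_norm_ell2: "(norm x)\<^sup>2 = (\<Sum>\<^sub>\<infinity>i. (cmod (ell2_coeff x i))\<^sup>2)"
  by (simp add: power2_norm_eq_inner inner_ell2_self)

lemma sum_coeff_le_norm:
  assumes "finite F"
  shows "(\<Sum>i\<in>F. (cmod (ell2_coeff x i))\<^sup>2) \<le> (norm x)\<^sup>2"
  unfolding power2_norm_ell2
  by (rule finite_sum_le_infsum) (use assms ell2_coeff_summable in auto)

lemma norm_coeff_le: "cmod (ell2_coeff x i) \<le> norm x"
  using cinner_norm_le[of "ell2_basis i" x] by (simp add: cinner_basis norm_ell2_basis)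

text \<open>
  Coefficientwise limits of a Cauchy sequence exist. The partial sums of the squared distance to the
  limit over finite index sets inherit the Cauchy bound, which gives both square summability and
  convergence in norm.
\<close>
instance ell2 :: (type) banach
proof
  fix X :: "nat \<Rightarrow> 'a ell2"
  assume C: "Cauchy X"
  define f where "f i = lim (\<lambda>n. ell2_coeff (X n) i)" for i
  have lim: "(\<lambda>n. ell2_coeff (X n) i) \<longlonglongrightarrow> f i" for i
  proof -
    have "Cauchy (\<lambda>n. ell2_coeff (X n) i)"
    proof (rule CauchyI)
      fix e :: real assume "0 < e"
      then obtain M where "\<forall>m\<ge>M. \<forall>n\<ge>M. norm (X m - X n) < e" using CauchyD[OF C] by blast
      then show "\<exists>M. \<forall>m\<ge>M. \<forall>n\<ge>M. norm (ell2_coeff (X m) i - ell2_coeff (X n) i) < e"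
        by (metis minus_ell2.rep_eq norm_coeff_le order_le_less_trans)
    qed
    then show ?thesis by (simp add: f_def Cauchy_convergent_iff convergent_LIMSEQ_iff)
  qed
  have bound: "(\<lambda>i. (cmod (ell2_coeff (X n) i - f i))\<^sup>2) summable_on UNIV \<and>
      (\<Sum>\<^sub>\<infinity>i. (cmod (ell2_coeff (X n) i - f i))\<^sup>2) \<le> e\<^sup>2"
    if n: "\<And>m. m \<ge> M \<Longrightarrow> norm (X n - X m) \<le> e" for n M e
  proof -
    have fin: "(\<Sum>i\<in>F. (cmod (ell2_coeff (X n) i - f i))\<^sup>2) \<le> e\<^sup>2" if "finite F" for F
    proof (rule LIMSEQ_le_const2)
      show "(\<lambda>m. \<Sum>i\<in>F. (cmod (ell2_coeff (X n) i - ell2_coeff (X m) i))\<^sup>2)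
          \<longlonglongrightarrow> (\<Sum>i\<in>F. (cmod (ell2_coeff (X n) i - f i))\<^sup>2)"
        by (intro tendsto_intros lim)
      have "(\<Sum>i\<in>F. (cmod (ell2_coeff (X n) i - ell2_coeff (X m) i))\<^sup>2) \<le> e\<^sup>2" if "m \<ge> M" for m
      proof -
        have "(\<Sum>i\<in>F. (cmod (ell2_coeff (X n - X m) i))\<^sup>2) \<le> (norm (X n - X m))\<^sup>2"
          by (rule sum_coeff_le_norm) fact
        also have "\<dots> \<le> e\<^sup>2" using n[OF that] by (intro power_mono) auto
        finally show ?thesis by (simp add: minus_ell2.rep_eq)
      qed
      then show "\<exists>N. \<forall>m\<ge>N. (\<Sum>i\<in>F. (cmod (ell2_coeff (X n) i - ell2_coeff (X m) i))\<^sup>2) \<le> e\<^sup>2"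
        by blast
    qed
    have s: "(\<lambda>i. (cmod (ell2_coeff (X n) i - f i))\<^sup>2) summable_on UNIV"
      by (rule nonneg_bdd_above_summable_on) (use fin in \<open>auto intro!: bdd_aboveI2\<close>)
    moreover have "(\<Sum>\<^sub>\<infinity>i. (cmod (ell2_coeff (X n) i - f i))\<^sup>2) \<le> e\<^sup>2"
      by (rule infsum_le_finite_sums[OF s]) (use fin in auto)
    ultimately show ?thesis by blast
  qed
  obtain M where M: "\<And>m n. m \<ge> M \<Longrightarrow> n \<ge> M \<Longrightarrow> norm (X m - X n) < 1"
    using CauchyD[OF C, of 1] by auto
  have "(\<lambda>i. (cmod (ell2_coeff (X M) i - f i))\<^sup>2) summable_on UNIV"
    using bound[of M M 1] M by (simp add: less_imp_le)
  from square_summable_add[OF ell2_coeff_summable[of "X M"] square_summable_scale[OF this, of "-1"]]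
  have "(\<lambda>i. (cmod (f i))\<^sup>2) summable_on UNIV" by simp
  then have f: "ell2_coeff (Abs_ell2 f) = f" by (simp add: Abs_ell2_inverse)
  have "X \<longlonglongrightarrow> Abs_ell2 f"
  proof (rule LIMSEQ_I)
    fix e :: real assume "0 < e"
    then obtain N where N: "\<And>m n. m \<ge> N \<Longrightarrow> n \<ge> N \<Longrightarrow> norm (X m - X n) < e / 2"
      using CauchyD[OF C, of "e / 2"] by auto
    have "norm (X n - Abs_ell2 f) < e" if "n \<ge> N" for n
    proof -
      have "(norm (X n - Abs_ell2 f))\<^sup>2 \<le> (e / 2)\<^sup>2"
        unfolding power2_norm_ell2 minus_ell2.rep_eq f
        using bound[of N n "e / 2"] N[OF that] by (simp add: less_imp_le)
      then have "norm (X n - Abs_ell2 f) \<le> e / 2"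
        using \<open>0 < e\<close> by (simp add: power2_le_iff_abs_le)
      then show ?thesis using \<open>0 < e\<close> by simp
    qed
    then show "\<exists>N. \<forall>n\<ge>N. norm (X n - Abs_ell2 f) < e" by blast
  qed
  then show "convergent X" by (rule convergentI)
qed

lemma coeff_sum:
  "ell2_coeff (\<Sum>i\<in>F. g i) j = (\<Sum>i\<in>F. ell2_coeff (g i) j)"
  by (induction F rule: infinite_finite_induct) (auto simp: zero_ell2.rep_eq plus_ell2.rep_eq)

lemma finite_support_approx:
  assumes "0 < e"
  obtains F where "finite F" "norm (x - (\<Sum>w\<in>F. ell2_coeff x w *\<^sub>C ell2_basis w)) < e"
proof -
  let ?h = "\<lambda>i. (cmod (ell2_coeff x i))\<^sup>2"
  have hs: "(?h has_sum infsum ?h UNIV) UNIV"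
    by (rule has_sum_infsum[OF ell2_coeff_summable])
  obtain F where F: "finite F" "dist (sum ?h F) (infsum ?h UNIV) < e\<^sup>2"
    using tendstoD[OF hs[unfolded has_sum_def], of "e\<^sup>2"] \<open>0 < e\<close>
    unfolding eventually_finite_subsets_at_top by auto
  let ?y = "\<Sum>w\<in>F. ell2_coeff x w *\<^sub>C ell2_basis w"
  have y: "ell2_coeff ?y i = (if i \<in> F then ell2_coeff x i else 0)" for i
    using F(1) by (simp add: coeff_sum scaleC.rep_eq ell2_basis.rep_eq if_distrib cong: if_cong)
  have "(norm (x - ?y))\<^sup>2 = infsum ?h (UNIV - F)"
    unfolding power2_norm_ell2
    by (rule infsum_cong_neutral) (auto simp: minus_ell2.rep_eq y)
  also have "\<dots> = infsum ?h UNIV - infsum ?h F"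
    by (rule infsum_Diff) (use F ell2_coeff_summable in auto)
  also have "\<dots> < e\<^sup>2" using F by (simp add: dist_real_def)
  finally have "norm (x - ?y) < e" using \<open>0 < e\<close> by (simp add: power2_less_imp_less)
  with F(1) show thesis by (rule that)
qed

section \<open>Adjoints and the disk algebra\<close>

definition adjointable :: "'a op \<Rightarrow> bool"
  where "adjointable A \<longleftrightarrow> (\<exists>B :: 'a op. \<forall>x y. cinner (A x) y = cinner x (B y))"

lemma adj_eqI:
  fixes A B :: "'a op"
  assumes "\<And>x y. cinner (A x) y = cinner x (B y)"
  shows "adj A = B"
  unfolding adj_def
proof (rule the_equality)
  show "C = B" if "\<forall>x y. cinner (A x) y = cinner x (C y)" for C :: "'a op"
    by (rule blinfun_eqI, rule cinner_eqI) (use assms that in metis)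
qed (use assms in blast)

lemma adjointableI:
  fixes A B :: "'a op"
  assumes "\<And>x y. cinner (A x) y = cinner x (B y)"
  shows "adjointable A"
  using assms unfolding adjointable_def by blast

lemma cinner_adj:
  assumes "adjointable A"
  shows "cinner (A x) y = cinner x (adj A y)"
  using assms adj_eqI unfolding adjointable_def by metis

lemma cinner_adj':
  assumes "adjointable A"
  shows "cinner (adj A x) y = cinner x (A y)"
  by (metis assms cinner_adj cinner_cnj)

lemma adjointable_adj: "adjointable A \<Longrightarrow> adjointable (adj A)"
  by (rule adjointableI) (rule cinner_adj')

lemma adj_adj: "adjointable A \<Longrightarrow> adj (adj A) = A"
  by (rule adj_eqI) (rule cinner_adj')

lemma adjointable_id: "adjointable id_blinfun"
  by (rule adjointableI[of _ id_blinfun]) simp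

lemma adj_id: "adj id_blinfun = id_blinfun"
  by (rule adj_eqI) simp

lemma adj_zero: "adj 0 = 0"
  by (rule adj_eqI) simp

lemma
  assumes "adjointable A" "adjointable B"
  shows adjointable_add: "adjointable (A + B)"
    and adj_add: "adj (A + B) = adj A + adj B"
proof -
  have *: "cinner ((A + B) x) y = cinner x ((adj A + adj B) y)" for x y
    using assms by (simp add: blinfun.add_left cinner_add_left cinner_add_right cinner_adj)
  show "adjointable (A + B)" by (rule adjointableI) (rule *)
  show "adj (A + B) = adj A + adj B" by (rule adj_eqI) (rule *)
qed

lemma
  assumes "adjointable A" "adjointable B"
  shows adjointable_diff: "adjointable (A - B)"
    and adj_diff: "adj (A - B) = adj A - adj B"
proof -
  have *: "cinner ((A - B) x) y = cinner x ((adj A - adj B) y)" for x y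
    using assms by (simp add: blinfun.diff_left cinner_diff_left cinner_diff_right cinner_adj)
  show "adjointable (A - B)" by (rule adjointableI) (rule *)
  show "adj (A - B) = adj A - adj B" by (rule adj_eqI) (rule *)
qed

lemma
  assumes "adjointable A" "adjointable B"
  shows adjointable_comp: "adjointable (A o\<^sub>L B)"
    and adj_comp: "adj (A o\<^sub>L B) = adj B o\<^sub>L adj A"
proof -
  have *: "cinner ((A o\<^sub>L B) x) y = cinner x ((adj B o\<^sub>L adj A) y)" for x y
    using assms by (simp add: cinner_adj)
  show "adjointable (A o\<^sub>L B)" by (rule adjointableI) (rule *)
  show "adj (A o\<^sub>L B) = adj B o\<^sub>L adj A" by (rule adj_eqI) (rule *)
qed

lemma
  assumes "adjointable A"
  shows adjointable_op_scaleC: "adjointable (op_scaleC c A)"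
    and adj_op_scaleC: "adj (op_scaleC c A) = op_scaleC (cnj c) (adj A)"
proof -
  have *: "cinner (op_scaleC c A x) y = cinner x (op_scaleC (cnj c) (adj A) y)" for x y
    using assms by (simp add: op_scaleC_apply cinner_scaleC_left cinner_scaleC_right cinner_adj)
  show "adjointable (op_scaleC c A)" by (rule adjointableI) (rule *)
  show "adj (op_scaleC c A) = op_scaleC (cnj c) (adj A)" by (rule adj_eqI) (rule *)
qed

lemma norm_adj_le:
  assumes "adjointable A"
  shows "norm (adj A) \<le> norm A"
proof (rule norm_blinfun_bound)
  fix y
  have "(norm (adj A y))\<^sup>2 = cmod (cinner (A (adj A y)) y)"
    using assms by (simp add: cinner_adj cinner_self norm_power)
  also have "\<dots> \<le> norm (A (adj A y)) * norm y" by (rule cinner_norm_le)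
  also have "\<dots> \<le> norm A * norm (adj A y) * norm y"
    by (intro mult_right_mono norm_blinfun) simp
  finally have "norm (adj A y) * norm (adj A y) \<le> norm (adj A y) * (norm A * norm y)"
    by (simp add: power2_eq_square mult_ac)
  then show "norm (adj A y) \<le> norm A * norm y"
    by (cases "adj A y = 0") (auto simp: mult_le_cancel_left)
qed simp

text \<open>
  Since taking adjoints does not increase norms, the adjoints of a convergent sequence form a Cauchy
  sequence; completeness of the operator space provides the adjoint of the limit.
\<close>
lemma
  assumes A: "\<And>n. adjointable (A n)" and lim: "A \<longlonglongrightarrow> L"
  shows adjointable_limit: "adjointable L"
    and tendsto_adj: "(\<lambda>n. adj (A n)) \<longlonglongrightarrow> adj L"
proof -
  have "Cauchy (\<lambda>n. adj (A n))"
  proof (rule CauchyI)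
    fix e :: real assume "0 < e"
    then obtain M where "\<forall>m\<ge>M. \<forall>n\<ge>M. norm (A m - A n) < e"
      using CauchyD[OF LIMSEQ_imp_Cauchy[OF lim]] by blast
    then show "\<exists>M. \<forall>m\<ge>M. \<forall>n\<ge>M. norm (adj (A m) - adj (A n)) < e"
      by (metis A adj_diff adjointable_diff norm_adj_le order_le_less_trans)
  qed
  then obtain B where B: "(\<lambda>n. adj (A n)) \<longlonglongrightarrow> B"
    by (auto simp: Cauchy_convergent_iff convergent_def)
  have *: "cinner (L x) y = cinner x (B y)" for x y
  proof (rule LIMSEQ_unique)
    show "(\<lambda>n. cinner (A n x) y) \<longlonglongrightarrow> cinner (L x) y"
      by (intro tendsto_intros lim)
    show "(\<lambda>n. cinner (A n x) y) \<longlonglongrightarrow> cinner x (B y)"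
      unfolding cinner_adj[OF A] by (intro tendsto_intros B)
  qed
  show "adjointable L" by (rule adjointableI) (rule *)
  show "(\<lambda>n. adj (A n)) \<longlonglongrightarrow> adj L" using B adj_eqI[OF *] by simp
qed

lemma op_scaleC_eq_comp: "op_scaleC c A = Blinfun (scaleC c) o\<^sub>L A"
  by (rule blinfun_eqI) (simp add: op_scaleC_apply bounded_linear_Blinfun_apply bounded_linear_scaleC)

lemmas tendsto_blinfun_compose [tendsto_intros] =
  bounded_bilinear.tendsto[OF bounded_bilinear_blinfun_compose]

text \<open>Splitting the scalar into real and imaginary part reduces joint continuity to that of real scalar
  multiplication and of composition.\<close>
lemma tendsto_op_scaleC [tendsto_intros]:
  fixes g :: "'b \<Rightarrow> 'a op"
  assumes "(f \<longlongrightarrow> c) F" "(g \<longlongrightarrow> A) F"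
  shows "((\<lambda>n. op_scaleC (f n) (g n)) \<longlongrightarrow> op_scaleC c A) F"
proof -
  have *: "op_scaleC c A = Re c *\<^sub>R A + Im c *\<^sub>R op_scaleC \<i> A" for c and A :: "'a op"
  proof (rule blinfun_eqI)
    fix x
    have "c *\<^sub>C A x = (of_real (Re c) + of_real (Im c) * \<i>) *\<^sub>C A x"
      by (subst complex_eq[of c]) (simp add: mult.commute)
    also have "\<dots> = Re c *\<^sub>R A x + Im c *\<^sub>R \<i> *\<^sub>C A x"
      unfolding scaleR_ell2_def by transfer (simp add: algebra_simps)
    finally show "op_scaleC c A x = (Re c *\<^sub>R A + Im c *\<^sub>R op_scaleC \<i> A) x"
      by (simp add: op_scaleC_apply blinfun.add_left blinfun.scaleR_left)
  qed
  then show ?thesis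
    unfolding *[of "f _" "g _"] *[of c A] op_scaleC_eq_comp[of \<i>]
    by (intro tendsto_intros assms)
qed

lemma blinfun_compose_id: "id_blinfun o\<^sub>L A = A" "A o\<^sub>L id_blinfun = A"
  by (simp_all add: blinfun_eqI)

lemma blinfun_compose_assoc: "(A o\<^sub>L B) o\<^sub>L C = A o\<^sub>L (B o\<^sub>L C)"
  by (simp add: blinfun_eqI)

lemma op_subalgebra_disk_algebra: "op_subalgebra disk_algebra"
  unfolding disk_algebra_def op_subalgebra_def by auto

lemma
  shows disk_algebra_id: "id_blinfun \<in> disk_algebra"
    and disk_algebra_add: "a \<in> disk_algebra \<Longrightarrow> b \<in> disk_algebra \<Longrightarrow> a + b \<in> disk_algebra"
    and disk_algebra_comp: "a \<in> disk_algebra \<Longrightarrow> b \<in> disk_algebra \<Longrightarrow> a o\<^sub>L b \<in> disk_algebra"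
    and disk_algebra_scale: "a \<in> disk_algebra \<Longrightarrow> op_scaleC c a \<in> disk_algebra"
  using op_subalgebra_disk_algebra unfolding op_subalgebra_def by blast+

lemma disk_algebra_shift: "left_shift k \<in> disk_algebra"
  unfolding disk_algebra_def by auto

lemma op_scaleC_minus_one: "op_scaleC (-1) a = - a"
  by (rule blinfun_eqI) (simp add: op_scaleC_apply scaleC_minus_one blinfun.minus_left)

lemma op_scaleC_of_real: "op_scaleC (of_real r) a = r *\<^sub>R a"
  by (rule blinfun_eqI) (simp add: op_scaleC_apply blinfun.scaleR_left scaleR_ell2_def)

lemma disk_algebra_uminus: "a \<in> disk_algebra \<Longrightarrow> - a \<in> disk_algebra"
  using disk_algebra_scale[of a "-1"] by (simp add: op_scaleC_minus_one)

lemma disk_algebra_diff: "a \<in> disk_algebra \<Longrightarrow> b \<in> disk_algebra \<Longrightarrow> a - b \<in> disk_algebra"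
  using disk_algebra_add[of a "- b"] by (simp add: disk_algebra_uminus)

lemma disk_algebra_scaleR: "a \<in> disk_algebra \<Longrightarrow> r *\<^sub>R a \<in> disk_algebra"
  using disk_algebra_scale[of a "of_real r"] by (simp add: op_scaleC_of_real)

lemma disk_algebra_zero: "0 \<in> disk_algebra"
  using disk_algebra_scaleR[OF disk_algebra_id, of 0] by simp

lemma closed_disk_algebra: "closed disk_algebra"
  unfolding disk_algebra_def by (rule closed_Inter) blast

lemma disk_algebra_induct [consumes 1, case_names id shift add comp scale limit]:
  assumes a: "a \<in> disk_algebra"
    and id: "P id_blinfun"
    and shift: "\<And>k. P (left_shift k)"
    and add: "\<And>a b. a \<in> disk_algebra \<Longrightarrow> b \<in> disk_algebra \<Longrightarrow> P a \<Longrightarrow> P b \<Longrightarrow> P (a + b)"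
    and comp: "\<And>a b. a \<in> disk_algebra \<Longrightarrow> b \<in> disk_algebra \<Longrightarrow> P a \<Longrightarrow> P b \<Longrightarrow> P (a o\<^sub>L b)"
    and scale: "\<And>c a. a \<in> disk_algebra \<Longrightarrow> P a \<Longrightarrow> P (op_scaleC c a)"
    and limit: "\<And>X a. (\<And>n. X n \<in> disk_algebra) \<Longrightarrow> (\<And>n. P (X n)) \<Longrightarrow> X \<longlonglongrightarrow> a \<Longrightarrow> P a"
  shows "P a"
proof -
  let ?S = "{a \<in> disk_algebra. P a}"
  have "op_subalgebra ?S"
    unfolding op_subalgebra_def
    by (intro conjI ballI allI)
       (simp_all add: disk_algebra_id disk_algebra_add disk_algebra_comp disk_algebra_scale
         id add comp scale)
  moreover have "closed ?S"
    unfolding closed_sequential_limits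
  proof (intro allI impI, elim conjE)
    fix X l assume X: "\<forall>n. X n \<in> ?S" "X \<longlonglongrightarrow> l"
    then have "l \<in> disk_algebra"
      by (auto intro!: closed_sequentially[OF closed_disk_algebra _ X(2)])
    moreover have "P l" using X(1) by (auto intro!: limit[OF _ _ X(2)])
    ultimately show "l \<in> ?S" by simp
  qed
  moreover have "range left_shift \<subseteq> ?S" using shift disk_algebra_shift by auto
  ultimately have "disk_algebra \<subseteq> ?S" unfolding disk_algebra_def by blast
  with a show ?thesis by blast
qed

lemma left_shift_apply: "left_shift k x = shift_vec k x"
  by (simp add: left_shift_def bounded_linear_Blinfun_apply bounded_linear_shift_vec)

lemma left_shift_coeff:
  "ell2_coeff (left_shift k x) w = (case w of [] \<Rightarrow> 0 | j # v \<Rightarrow> if j = k then ell2_coeff x v else 0)"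
  by (simp add: left_shift_apply shift_vec.rep_eq)

lift_definition backward_shift_vec :: "'d \<Rightarrow> 'd list ell2 \<Rightarrow> 'd list ell2"
  is "\<lambda>k f w. f (k # w)"
proof -
  fix k :: 'd and f :: "'d list \<Rightarrow> complex"
  assume "(\<lambda>i. (cmod (f i))\<^sup>2) summable_on UNIV"
  then have "(\<lambda>i. (cmod (f i))\<^sup>2) summable_on range ((#) k)"
    by (rule summable_on_subset_banach) simp
  then have "((\<lambda>i. (cmod (f i))\<^sup>2) \<circ> (#) k) summable_on UNIV"
    by (subst (asm) summable_on_reindex) auto
  then show "(\<lambda>w. (cmod (f (k # w)))\<^sup>2) summable_on UNIV" by (simp add: o_def)
qed

lemma cinner_shift_vec: "cinner (shift_vec k x) y = cinner x (backward_shift_vec k y)"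
proof -
  let ?h = "\<lambda>w. cnj (ell2_coeff (shift_vec k x) w) * ell2_coeff y w"
  have "cinner (shift_vec k x) y = infsum ?h (range ((#) k))"
    unfolding cinner.rep_eq
    by (rule infsum_cong_neutral) (auto simp: shift_vec.rep_eq split: list.splits)
  also have "\<dots> = infsum (?h \<circ> (#) k) UNIV" by (rule infsum_reindex) simp
  also have "\<dots> = cinner x (backward_shift_vec k y)"
    unfolding cinner.rep_eq by (simp add: o_def shift_vec.rep_eq backward_shift_vec.rep_eq)
  finally show ?thesis .
qed

lemma bounded_linear_backward_shift_vec: "bounded_linear (backward_shift_vec k)"
proof (rule bounded_linear_intro[where K = 1])
  show "backward_shift_vec k (x + y) = backward_shift_vec k x + backward_shift_vec k y" for x y
    by transfer simp
  show "backward_shift_vec k (r *\<^sub>R x) = r *\<^sub>R backward_shift_vec k x" for r x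
    unfolding scaleR_ell2_def by transfer simp
  show "norm (backward_shift_vec k y) \<le> norm y * 1" for y
  proof -
    let ?z = "backward_shift_vec k y"
    have "(norm ?z)\<^sup>2 = cmod (cinner (shift_vec k ?z) y)"
      by (simp add: cinner_shift_vec cinner_self norm_power)
    also have "\<dots> \<le> norm ?z * norm y" using cinner_norm_le norm_shift_vec by metis
    finally show ?thesis
      by (cases "?z = 0") (auto simp: power2_eq_square mult_le_cancel_left)
  qed
qed

lemma
  shows adjointable_left_shift: "adjointable (left_shift k)"
    and adj_left_shift_apply: "adj (left_shift k) x = backward_shift_vec k x"
proof -
  have *: "cinner (left_shift k x) y = cinner x (Blinfun (backward_shift_vec k) y)" for x y
    by (simp add: left_shift_apply bounded_linear_Blinfun_apply bounded_linear_backward_shift_vec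
        cinner_shift_vec)
  show "adjointable (left_shift k)" by (rule adjointableI) (rule *)
  show "adj (left_shift k) x = backward_shift_vec k x"
    using adj_eqI[OF *]
    by (simp add: bounded_linear_Blinfun_apply bounded_linear_backward_shift_vec)
qed

lemma adjointable_disk_algebra: "a \<in> disk_algebra \<Longrightarrow> adjointable a"
proof (induction rule: disk_algebra_induct)
  case (limit X a)
  show ?case by (rule adjointable_limit[OF limit.IH limit.hyps(2)])
qed (simp_all add: adjointable_id adjointable_left_shift adjointable_add adjointable_comp
    adjointable_op_scaleC)

section \<open>Products of adjoints with elements of the disk algebra\<close>

lemma adj_left_shift_comp_left_shift:
  "adj (left_shift k) o\<^sub>L left_shift j = (if j = k then id_blinfun else 0)"
  by (rule blinfun_eqI, rule ell2_coeff_inject[THEN iffD1], rule ext)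
     (auto simp: adj_left_shift_apply backward_shift_vec.rep_eq left_shift_coeff zero_ell2.rep_eq)

text \<open>The vacuum expectation is a character, because the vacuum is a joint eigenvector of all
  adjoints.\<close>
lemma vacuum_character:
  "a \<in> disk_algebra \<Longrightarrow> cinner vac (a x) = cinner vac (a vac) * cinner vac x"
proof (induction arbitrary: x rule: disk_algebra_induct)
  case id
  show ?case by (simp add: cinner_self norm_ell2_basis)
next
  case (shift k)
  show ?case by (simp add: cinner_basis left_shift_coeff)
next
  case (add a b)
  show ?case
    using add.IH[of x] by (simp add: blinfun.add_left cinner_add_right distrib_right)
next
  case (comp a b)
  show ?case
    using comp.IH(1)[of "b x"] comp.IH(1)[of "b vac"] comp.IH(2)[of x] by simp
next
  case (scale c a)
  show ?case
    using scale.IH[of x] by (simp add: op_scaleC_apply cinner_scaleC_right)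
next
  case (limit X a)
  show ?case
  proof (rule LIMSEQ_unique)
    show "(\<lambda>n. cinner vac (X n x)) \<longlonglongrightarrow> cinner vac (a x)"
      by (intro tendsto_intros limit.hyps)
    have "(\<lambda>n. cinner vac (X n vac) * cinner vac x) \<longlonglongrightarrow> cinner vac (a vac) * cinner vac x"
      by (intro tendsto_intros limit.hyps)
    then show "(\<lambda>n. cinner vac (X n x)) \<longlonglongrightarrow> cinner vac (a vac) * cinner vac x"
      by (subst limit.IH)
  qed
qed

lemma op_scaleC_scaleC: "op_scaleC c (op_scaleC d A) = op_scaleC (c * d) A"
  by (rule blinfun_eqI) (simp add: op_scaleC_apply scaleC_scaleC)

lemma op_scaleC_comp_left: "op_scaleC c A o\<^sub>L B = op_scaleC c (A o\<^sub>L B)"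
  by (rule blinfun_eqI) (simp add: op_scaleC_apply)

lemma op_scaleC_add: "op_scaleC c (A + B) = op_scaleC c A + op_scaleC c B"
  by (rule blinfun_eqI) (simp add: op_scaleC_apply blinfun.add_left scaleC_add_right)

lemma op_scaleC_diff: "op_scaleC c (A - B) = op_scaleC c A - op_scaleC c B"
  using op_scaleC_add[of c "A - B" B] by simp

lemma op_scaleC_add_scalar: "op_scaleC (c + d) A = op_scaleC c A + op_scaleC d A"
  by (rule blinfun_eqI, simp add: op_scaleC_apply blinfun.add_left) (transfer, simp add: distrib_right)

lemma op_scaleC_one: "op_scaleC 1 A = A"
  by (rule blinfun_eqI) (simp add: op_scaleC_apply scaleC_one)

lemma op_scaleC_zero: "op_scaleC 0 A = 0"
  by (rule blinfun_eqI) (simp add: op_scaleC_apply scaleC_zero)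

lemma comp_op_scaleC_adj:
  "adjointable A \<Longrightarrow> A o\<^sub>L op_scaleC c B = op_scaleC c (A o\<^sub>L B)"
  by (rule blinfun_eqI, rule cinner_eqI)
     (simp add: op_scaleC_apply cinner_scaleC_right flip: cinner_adj')

text \<open>
  Up to its vacuum part, an element of the disk algebra is a combination of products
  \<open>left_shift j o\<^sub>L b\<close> with \<open>b\<close> in the algebra, and the adjoint of a shift cancels the shift. The scalar in front
  of the remaining adjoint has to be the vacuum expectation, which makes the statement stable
  under norm limits.
\<close>
lemma adj_left_shift_comp_disk_algebra:
  "b \<in> disk_algebra \<Longrightarrow>
    (adj (left_shift k) o\<^sub>L b) - op_scaleC (cinner vac (b vac)) (adj (left_shift k)) \<in> disk_algebra"
proof (induction rule: disk_algebra_induct)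
  case id
  show ?case
    by (simp add: cinner_self norm_ell2_basis op_scaleC_one disk_algebra_zero blinfun_compose_id(2))
next
  case (shift j)
  have "cinner vac (left_shift j vac) = 0" by (simp add: cinner_basis left_shift_coeff)
  then show ?case
    by (simp add: adj_left_shift_comp_left_shift op_scaleC_zero disk_algebra_id disk_algebra_zero)
next
  case (add a b)
  from disk_algebra_add[OF add.IH] show ?case
    by (simp add: blinfun.add_left cinner_add_right op_scaleC_add_scalar
        bounded_bilinear.add_right[OF bounded_bilinear_blinfun_compose] algebra_simps)
next
  case (comp a b)
  let ?L = "adj (left_shift k)" and ?f = "\<lambda>a. cinner vac (a vac)"
  have "(((?L o\<^sub>L a) - op_scaleC (?f a) ?L) o\<^sub>L b) + op_scaleC (?f a) ((?L o\<^sub>L b) - op_scaleC (?f b) ?L)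
      \<in> disk_algebra"
    by (intro disk_algebra_add disk_algebra_comp disk_algebra_scale comp)
  also have "(((?L o\<^sub>L a) - op_scaleC (?f a) ?L) o\<^sub>L b) + op_scaleC (?f a) ((?L o\<^sub>L b) - op_scaleC (?f b) ?L)
      = (?L o\<^sub>L (a o\<^sub>L b)) - op_scaleC (?f a * ?f b) ?L"
    by (simp add: bounded_bilinear.diff_left[OF bounded_bilinear_blinfun_compose] op_scaleC_diff
        op_scaleC_scaleC op_scaleC_comp_left blinfun_compose_assoc)
  also have "?f a * ?f b = ?f (a o\<^sub>L b)"
    using vacuum_character[OF comp.hyps(1), of "b vac"] by simp
  finally show ?case .
next
  case (scale c a)
  from disk_algebra_scale[OF scale.IH, of c] show ?case
    by (simp add: op_scaleC_diff op_scaleC_scaleC op_scaleC_apply cinner_scaleC_right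
        comp_op_scaleC_adj adjointable_adj adjointable_left_shift)
next
  case (limit X a)
  show ?case
  proof (rule closed_sequentially[OF closed_disk_algebra limit.IH])
    show "(\<lambda>n. (adj (left_shift k) o\<^sub>L X n) - op_scaleC (cinner vac (X n vac)) (adj (left_shift k)))
        \<longlonglongrightarrow> (adj (left_shift k) o\<^sub>L a) - op_scaleC (cinner vac (a vac)) (adj (left_shift k))"
      by (intro tendsto_intros limit.hyps)
  qed
qed

definition presystem :: "'d::finite list op set"
  where "presystem = {a + adj b | a b. a \<in> disk_algebra \<and> b \<in> disk_algebra}"

lemma disk_system_eq: "disk_system = closure presystem"
  unfolding disk_system_def presystem_def ..

lemma presystem_add: "s \<in> presystem \<Longrightarrow> t \<in> presystem \<Longrightarrow> s + t \<in> presystem"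
proof -
  assume "s \<in> presystem" "t \<in> presystem"
  then obtain a b c d where *: "a \<in> disk_algebra" "b \<in> disk_algebra" "c \<in> disk_algebra"
    "d \<in> disk_algebra" and st: "s = a + adj b" "t = c + adj d"
    unfolding presystem_def by blast
  have "s + t = (a + c) + adj (b + d)"
    using * by (simp add: st adj_add adjointable_disk_algebra)
  with * show ?thesis unfolding presystem_def by (auto intro: disk_algebra_add)
qed

lemma presystem_scale: "s \<in> presystem \<Longrightarrow> op_scaleC c s \<in> presystem"
proof -
  assume "s \<in> presystem"
  then obtain a b where *: "a \<in> disk_algebra" "b \<in> disk_algebra" and s: "s = a + adj b"
    unfolding presystem_def by blast
  have "op_scaleC c s = op_scaleC c a + adj (op_scaleC (cnj c) b)"
    using * by (simp add: s op_scaleC_add adj_op_scaleC adjointable_disk_algebra)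
  with * show ?thesis unfolding presystem_def by (auto intro: disk_algebra_scale)
qed

lemma disk_system_add:
  assumes "s \<in> disk_system" "t \<in> disk_system"
  shows "s + t \<in> disk_system"
proof -
  obtain S T where "\<forall>n. S n \<in> presystem" "S \<longlonglongrightarrow> s" "\<forall>n. T n \<in> presystem" "T \<longlonglongrightarrow> t"
    using assms unfolding disk_system_eq closure_sequential by blast
  then have "\<forall>n. S n + T n \<in> presystem" "(\<lambda>n. S n + T n) \<longlonglongrightarrow> s + t"
    by (auto intro: presystem_add tendsto_add)
  then show ?thesis unfolding disk_system_eq closure_sequential by (intro exI conjI)
qed

lemma disk_system_scale:
  assumes "s \<in> disk_system"
  shows "op_scaleC c s \<in> disk_system"
proof -
  obtain S where "\<forall>n. S n \<in> presystem" "S \<longlonglongrightarrow> s"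
    using assms unfolding disk_system_eq closure_sequential by blast
  then have "\<forall>n. op_scaleC c (S n) \<in> presystem" "(\<lambda>n. op_scaleC c (S n)) \<longlonglongrightarrow> op_scaleC c s"
    by (auto intro: presystem_scale tendsto_op_scaleC)
  then show ?thesis unfolding disk_system_eq closure_sequential by (intro exI conjI)
qed

lemma presystem_subset: "presystem \<subseteq> disk_system"
  unfolding disk_system_eq by (rule closure_subset)

lemma disk_algebra_subset_disk_system: "(disk_algebra :: 'a::finite list op set) \<subseteq> disk_system"
proof
  fix a :: "'a list op" assume "a \<in> disk_algebra"
  moreover have "a = a + adj 0" by (simp add: adj_zero)
  ultimately have "a \<in> presystem" unfolding presystem_def using disk_algebra_zero by blast
  then show "a \<in> disk_system" using presystem_subset by blast
qed

text \<open>The adjoint of a shift maps the adjoint of \<open>b\<close> to that of \<open>b o\<^sub>L left_shift k\<close>, and an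
  element of the algebra to another one plus a multiple of the adjoint of the shift.\<close>
lemma adj_left_shift_comp_presystem:
  assumes "s \<in> presystem"
  shows "adj (left_shift k) o\<^sub>L s \<in> presystem"
proof -
  let ?L = "adj (left_shift k)"
  obtain a b where ab: "a \<in> disk_algebra" "b \<in> disk_algebra" and s: "s = a + adj b"
    using assms unfolding presystem_def by blast
  define c where "c = cinner vac (a vac)"
  define d where "d = op_scaleC (cnj c) (left_shift k) + (b o\<^sub>L left_shift k)"
  have d: "d \<in> disk_algebra"
    unfolding d_def by (intro disk_algebra_add disk_algebra_scale disk_algebra_comp disk_algebra_shift ab)
  have "adj d = op_scaleC c ?L + (?L o\<^sub>L adj b)"
    using ab unfolding d_def
    by (simp add: adj_add adj_comp adj_op_scaleC adjointable_comp adjointable_op_scaleC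
        adjointable_left_shift adjointable_disk_algebra)
  then have "?L o\<^sub>L s = ((?L o\<^sub>L a) - op_scaleC c ?L) + adj d"
    by (simp add: s bounded_bilinear.add_right[OF bounded_bilinear_blinfun_compose])
  moreover have "(?L o\<^sub>L a) - op_scaleC c ?L \<in> disk_algebra"
    unfolding c_def by (rule adj_left_shift_comp_disk_algebra[OF ab(1)])
  ultimately show ?thesis using d unfolding presystem_def by blast
qed

text \<open>
  The elements \<open>a\<close> with this property form a closed algebra, because the property concerns the
  whole system instead of the disk algebra alone; so it suffices to consider the shifts.
\<close>
lemma adj_disk_algebra_comp_disk_system:
  "a \<in> disk_algebra \<Longrightarrow> s \<in> disk_system \<Longrightarrow> adj a o\<^sub>L s \<in> disk_system"
proof (induction arbitrary: s rule: disk_algebra_induct)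
  case id
  then show ?case by (simp add: adj_id blinfun_compose_id(1))
next
  case (shift k)
  obtain S where S: "\<And>n. S n \<in> presystem" "S \<longlonglongrightarrow> s"
    using shift unfolding disk_system_eq closure_sequential by blast
  have "(\<lambda>n. adj (left_shift k) o\<^sub>L S n) \<longlonglongrightarrow> (adj (left_shift k) o\<^sub>L s)"
    by (intro tendsto_intros S)
  then show ?case
    unfolding disk_system_eq closure_sequential using adj_left_shift_comp_presystem[OF S(1)]
    by (intro exI[of _ "\<lambda>n. adj (left_shift k) o\<^sub>L S n"] conjI allI)
next
  case (add a b)
  then show ?case
    by (simp add: adj_add adjointable_disk_algebra disk_system_add
        bounded_bilinear.add_left[OF bounded_bilinear_blinfun_compose])
next
  case (comp a b)
  then show ?case
    by (simp add: adj_comp adjointable_disk_algebra blinfun_compose_assoc)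
next
  case (scale c a)
  then show ?case
    by (simp add: adj_op_scaleC adjointable_disk_algebra disk_system_scale op_scaleC_comp_left)
next
  case (limit X a)
  show ?case
  proof (rule closed_sequentially)
    show "closed disk_system" unfolding disk_system_eq by simp
    show "adj (X n) o\<^sub>L s \<in> disk_system" for n using limit.IH limit.prems by blast
    show "(\<lambda>n. adj (X n) o\<^sub>L s) \<longlonglongrightarrow> (adj a o\<^sub>L s)"
      by (intro tendsto_intros tendsto_adj limit.hyps adjointable_disk_algebra)
  qed
qed

lemma adj_comp_disk_system:
  "a \<in> disk_algebra \<Longrightarrow> b \<in> disk_algebra \<Longrightarrow> adj a o\<^sub>L b \<in> disk_system"
  using adj_disk_algebra_comp_disk_system disk_algebra_subset_disk_system by blast

section \<open>The disk algebra as a dense subspace of the Fock space\<close>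

lift_definition reverse_words :: "'d list ell2 \<Rightarrow> 'd list ell2" is "\<lambda>f w. f (rev w)"
proof -
  fix f :: "'d list \<Rightarrow> complex"
  assume "(\<lambda>i. (cmod (f i))\<^sup>2) summable_on UNIV"
  then show "(\<lambda>w. (cmod (f (rev w)))\<^sup>2) summable_on UNIV"
    using summable_on_reindex[of rev UNIV "\<lambda>i. (cmod (f i))\<^sup>2"]
    by (simp add: o_def surj_def) (metis rev_rev_ident surj_def)
qed

lemma norm_reverse_words: "norm (reverse_words x) = norm x"
proof -
  have "(norm x)\<^sup>2 = infsum (\<lambda>w. (cmod (ell2_coeff x w))\<^sup>2) (range rev)"
    by (simp add: power2_norm_ell2 surj_def) (metis rev_rev_ident surj_def)
  also have "\<dots> = infsum ((\<lambda>w. (cmod (ell2_coeff x w))\<^sup>2) \<circ> rev) UNIV"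
    by (rule infsum_reindex) simp
  also have "\<dots> = (norm (reverse_words x))\<^sup>2"
    by (simp add: power2_norm_ell2 reverse_words.rep_eq o_def)
  finally show ?thesis by (simp add: power2_eq_iff_nonneg)
qed

text \<open>Conjugated by the reversal of words, the left shift appends its letter at the end.\<close>
definition right_shift :: "'d \<Rightarrow> 'd list ell2 \<Rightarrow> 'd list ell2"
  where "right_shift k x = reverse_words (shift_vec k (reverse_words x))"

lemma bounded_linear_right_shift: "bounded_linear (right_shift k)"
proof -
  have "bounded_linear reverse_words"
  proof (rule bounded_linear_intro[where K = 1])
    show "reverse_words (x + y) = reverse_words x + reverse_words y" for x y :: "'d list ell2"
      by transfer simp
    show "reverse_words (r *\<^sub>R x) = r *\<^sub>R reverse_words x" for r and x :: "'d list ell2"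
      unfolding scaleR_ell2_def by transfer simp
  qed (simp add: norm_reverse_words)
  then show ?thesis
    unfolding right_shift_def
    by (intro bounded_linear_compose[OF _ bounded_linear_compose[OF bounded_linear_shift_vec]])
qed

lemma right_shift_coeff:
  "ell2_coeff (right_shift k x) w = (if w \<noteq> [] \<and> last w = k then ell2_coeff x (butlast w) else 0)"
  by (cases w rule: rev_cases)
     (auto simp: right_shift_def reverse_words.rep_eq shift_vec.rep_eq)

lemma right_shift_scaleC: "right_shift k (c *\<^sub>C x) = c *\<^sub>C right_shift k x"
  by (rule ell2_coeff_inject[THEN iffD1], rule ext) (simp add: right_shift_coeff scaleC.rep_eq)

lemma right_shift_basis: "right_shift k (ell2_basis w) = ell2_basis (w @ [k])"
  by (rule ell2_coeff_inject[THEN iffD1], rule ext)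
     (auto simp: right_shift_coeff ell2_basis.rep_eq)

text \<open>Letters added at the two ends of a word do not interfere, and the commutant is an algebra closed
  under limits.\<close>
lemma disk_algebra_commutes_right_shift:
  "a \<in> disk_algebra \<Longrightarrow> a (right_shift k x) = right_shift k (a x)"
proof (induction arbitrary: x rule: disk_algebra_induct)
  case id
  show ?case by simp
next
  case (shift j)
  show ?case
    by (rule ell2_coeff_inject[THEN iffD1], rule ext)
       (auto simp: right_shift_coeff left_shift_coeff split: list.splits)
next
  case (add a b)
  then show ?case
    by (simp add: blinfun.add_left linear_add[OF bounded_linear.linear[OF bounded_linear_right_shift]])
next
  case (comp a b)
  then show ?case by simp
next
  case (scale c a)
  then show ?case by (simp add: op_scaleC_apply right_shift_scaleC)
next
  case (limit X a)
  show ?case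
  proof (rule LIMSEQ_unique)
    show "(\<lambda>n. X n (right_shift k x)) \<longlonglongrightarrow> a (right_shift k x)"
      by (intro tendsto_intros limit.hyps)
    show "(\<lambda>n. X n (right_shift k x)) \<longlonglongrightarrow> right_shift k (a x)"
      unfolding limit.IH
      by (intro bounded_linear.tendsto[OF bounded_linear_right_shift] tendsto_intros limit.hyps)
  qed
qed

text \<open>
  If \<open>a\<close> annihilates the vacuum, it annihilates every basis vector, as these arise from the
  vacuum by right shifts; then the adjoint of \<open>a\<close> vanishes.
\<close>
lemma disk_algebra_separating:
  assumes a: "a \<in> disk_algebra" and "a vac = 0"
  shows "a = 0"
proof -
  have basis: "a (ell2_basis w) = 0" for w
  proof (induction w rule: rev_induct)
    case Nil
    show ?case by fact
  next
    case (snoc k w)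
    then show ?case
      by (simp add: disk_algebra_commutes_right_shift[OF a] flip: right_shift_basis)
         (simp add: linear_0[OF bounded_linear.linear[OF bounded_linear_right_shift]])
  qed
  have "adj a = 0"
  proof (rule blinfun_eqI, rule ell2_coeff_inject[THEN iffD1], rule ext)
    fix y w
    have "ell2_coeff (adj a y) w = cinner (a (ell2_basis w)) y"
      by (simp add: cinner_adj adjointable_disk_algebra a cinner_basis)
    then show "ell2_coeff (adj a y) w = ell2_coeff (blinfun_apply 0 y) w"
      by (simp add: basis zero_ell2.rep_eq)
  qed
  then show ?thesis by (metis a adj_adj adj_zero adjointable_disk_algebra)
qed

lemma inj_on_disk_algebra_vac: "inj_on (\<lambda>a :: 'd::finite list op. a vac) disk_algebra"
proof (rule inj_onI)
  fix a b :: "'d list op"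
  assume "a \<in> disk_algebra" "b \<in> disk_algebra" "a vac = b vac"
  then show "a = b"
    using disk_algebra_separating[of "a - b"] by (simp add: disk_algebra_diff blinfun.diff_left)
qed

lemma vec_op_vac: "a \<in> disk_algebra \<Longrightarrow> vec_op (a vac) = a"
  unfolding vec_op_def by (rule the_inv_into_f_f[OF inj_on_disk_algebra_vac])

lemma disk_vecs_zero: "0 \<in> disk_vecs"
  unfolding disk_vecs_def using disk_algebra_zero by (force simp: image_iff)

lemma disk_vecs_add: "x \<in> disk_vecs \<Longrightarrow> y \<in> disk_vecs \<Longrightarrow> x + y \<in> disk_vecs"
  unfolding disk_vecs_def image_iff using disk_algebra_add by (metis blinfun.add_left)

lemma disk_vecs_scale: "x \<in> disk_vecs \<Longrightarrow> c *\<^sub>C x \<in> disk_vecs"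
  unfolding disk_vecs_def image_iff using disk_algebra_scale by (metis op_scaleC_apply)

lemma disk_vecs_basis: "ell2_basis w \<in> disk_vecs"
proof (induction w)
  case Nil
  show ?case unfolding disk_vecs_def using disk_algebra_id by (force simp: image_iff)
next
  case (Cons k w)
  then obtain a where a: "a \<in> disk_algebra" "ell2_basis w = a vac" unfolding disk_vecs_def by blast
  then have "ell2_basis (k # w) = (left_shift k o\<^sub>L a) vac" by (simp flip: left_shift_basis)
  then show ?case
    unfolding disk_vecs_def using disk_algebra_comp[OF disk_algebra_shift a(1)] by blast
qed

lemma disk_vecs_approx:
  assumes "0 < e"
  obtains a where "a \<in> disk_algebra" "norm (x - a vac) < e"
proof -
  obtain F where F: "finite F" "norm (x - (\<Sum>w\<in>F. ell2_coeff x w *\<^sub>C ell2_basis w)) < e"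
    using finite_support_approx[OF assms] by blast
  from F(1) have "(\<Sum>w\<in>F. ell2_coeff x w *\<^sub>C ell2_basis w) \<in> disk_vecs"
    by (induction F rule: finite_induct)
       (auto intro: disk_vecs_zero disk_vecs_add disk_vecs_scale disk_vecs_basis)
  with F(2) that show thesis unfolding disk_vecs_def by auto
qed

lemma closure_disk_vecs: "closure disk_vecs = (UNIV :: 'd::finite list ell2 set)"
proof -
  have "x \<in> closure disk_vecs" for x :: "'d list ell2"
    unfolding closure_approachable
    by (metis disk_vecs_approx disk_vecs_def dist_commute dist_norm imageI)
  then show ?thesis by blast
qed

section \<open>The Gelfand--Naimark--Segal form of a positive measure\<close>

locale positive_nc_measure =
  fixes \<mu> :: "'d::finite list op \<Rightarrow> complex"
  assumes nc_measure: "nc_measure \<mu>"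
begin

abbreviation "form \<equiv> gns_form \<mu>"
abbreviation "snorm \<equiv> gns_seminorm \<mu>"

lemma form_add_right:
  "a \<in> disk_algebra \<Longrightarrow> b \<in> disk_algebra \<Longrightarrow> c \<in> disk_algebra \<Longrightarrow> form a (b + c) = form a b + form a c"
  using nc_measure unfolding nc_measure_def gns_form_def
  by (simp add: adj_comp_disk_system bounded_bilinear.add_right[OF bounded_bilinear_blinfun_compose])

lemma form_add_left:
  "a \<in> disk_algebra \<Longrightarrow> b \<in> disk_algebra \<Longrightarrow> c \<in> disk_algebra \<Longrightarrow> form (a + b) c = form a c + form b c"
  using nc_measure unfolding nc_measure_def gns_form_def
  by (simp add: adj_comp_disk_system bounded_bilinear.add_left[OF bounded_bilinear_blinfun_compose]
      adj_add adjointable_disk_algebra)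

lemma form_scale_right:
  "a \<in> disk_algebra \<Longrightarrow> b \<in> disk_algebra \<Longrightarrow> form a (op_scaleC c b) = c * form a b"
  using nc_measure unfolding nc_measure_def gns_form_def
  by (simp add: adj_comp_disk_system comp_op_scaleC_adj adjointable_adj adjointable_disk_algebra)

lemma form_scale_left:
  "a \<in> disk_algebra \<Longrightarrow> b \<in> disk_algebra \<Longrightarrow> form (op_scaleC c a) b = cnj c * form a b"
  using nc_measure unfolding nc_measure_def gns_form_def
  by (simp add: adj_comp_disk_system op_scaleC_comp_left adj_op_scaleC adjointable_disk_algebra)

lemma form_uminus_right:
  "a \<in> disk_algebra \<Longrightarrow> b \<in> disk_algebra \<Longrightarrow> form a (- b) = - form a b"
  using form_scale_right[of a b "-1"] by (simp add: op_scaleC_minus_one)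

lemma form_uminus_left:
  "a \<in> disk_algebra \<Longrightarrow> b \<in> disk_algebra \<Longrightarrow> form (- a) b = - form a b"
  using form_scale_left[of a b "-1"] by (simp add: op_scaleC_minus_one)

lemma form_diff_right:
  "a \<in> disk_algebra \<Longrightarrow> b \<in> disk_algebra \<Longrightarrow> c \<in> disk_algebra \<Longrightarrow> form a (b - c) = form a b - form a c"
  using form_add_right[of a b "- c"] by (simp add: form_uminus_right disk_algebra_uminus)

lemma form_diff_left:
  "a \<in> disk_algebra \<Longrightarrow> b \<in> disk_algebra \<Longrightarrow> c \<in> disk_algebra \<Longrightarrow> form (a - b) c = form a c - form b c"
  using form_add_left[of a "- b" c] by (simp add: form_uminus_left disk_algebra_uminus)

lemma form_self_nonneg:
  assumes a: "a \<in> disk_algebra"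
  shows "form a a \<in> \<real>\<^sub>\<ge>\<^sub>0"
proof -
  have "positive_op (adj a o\<^sub>L a)"
    unfolding positive_op_def
    by (simp add: cinner_self adjointable_disk_algebra a flip: cinner_adj)
  then show ?thesis
    using nc_measure adj_comp_disk_system[OF a a] unfolding nc_measure_def gns_form_def by blast
qed

lemma snorm_nonneg: "a \<in> disk_algebra \<Longrightarrow> 0 \<le> snorm a"
  using form_self_nonneg[of a] by (auto simp: gns_seminorm_def nonneg_Reals_def complex_nonneg_Reals_iff)

lemma form_self: "a \<in> disk_algebra \<Longrightarrow> form a a = of_real ((snorm a)\<^sup>2)"
  using form_self_nonneg[of a] by (simp add: gns_seminorm_def complex_nonneg_Reals_iff complex_eq_iff)

text \<open>A sesquilinear form that is real on the diagonal is Hermitian, by polarization.\<close>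
lemma form_cnj:
  assumes a: "a \<in> disk_algebra" and b: "b \<in> disk_algebra"
  shows "form b a = cnj (form a b)"
proof -
  have "form (a + b) (a + b) = form a a + form a b + form b a + form b b"
    by (simp add: form_add_left form_add_right disk_algebra_add a b)
  then have 1: "Im (form a b) + Im (form b a) = 0"
    by (simp add: form_self a b disk_algebra_add complex_eq_iff)
  have "form (a + op_scaleC \<i> b) (a + op_scaleC \<i> b)
      = form a a + \<i> * form a b - \<i> * form b a + form b b"
    by (simp add: form_add_left form_add_right form_scale_left form_scale_right
        disk_algebra_add disk_algebra_scale a b algebra_simps)
  then have 2: "Re (form a b) - Re (form b a) = 0"
    by (simp add: form_self a b disk_algebra_add disk_algebra_scale complex_eq_iff)
  from 1 2 show ?thesis by (simp add: complex_eq_iff)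
qed

lemma snorm_add_power2:
  assumes a: "a \<in> disk_algebra" and b: "b \<in> disk_algebra"
  shows "(snorm (a + b))\<^sup>2 = (snorm a)\<^sup>2 + 2 * Re (form a b) + (snorm b)\<^sup>2"
proof -
  have "form (a + b) (a + b) = form a a + form a b + form b a + form b b"
    by (simp add: form_add_left form_add_right disk_algebra_add a b)
  then have "Re (form (a + b) (a + b)) = Re (form a a + form a b + cnj (form a b) + form b b)"
    by (simp add: form_cnj[OF a b])
  then show ?thesis by (simp add: form_self a b disk_algebra_add del: of_real_power)
qed

lemma snorm_scale: "a \<in> disk_algebra \<Longrightarrow> snorm (op_scaleC c a) = cmod c * snorm a"
proof -
  assume a: "a \<in> disk_algebra"
  have "form (op_scaleC c a) (op_scaleC c a) = (cnj c * c) * form a a"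
    by (simp add: form_scale_left form_scale_right disk_algebra_scale a)
  also have "\<dots> = of_real ((cmod c * snorm a)\<^sup>2)"
    by (simp add: form_self a complex_norm_square[symmetric] power_mult_distrib mult.commute[of "cnj c"]
        del: of_real_power flip: of_real_mult)
  finally have "(snorm (op_scaleC c a))\<^sup>2 = (cmod c * snorm a)\<^sup>2"
    by (simp only: form_self a disk_algebra_scale of_real_eq_iff)
  then show ?thesis by (simp add: power2_eq_iff_nonneg snorm_nonneg a disk_algebra_scale)
qed

lemma snorm_scaleR: "a \<in> disk_algebra \<Longrightarrow> snorm (r *\<^sub>R a) = \<bar>r\<bar> * snorm a"
  using snorm_scale[of a "of_real r"] by (simp add: op_scaleC_of_real)

lemma snorm_uminus: "a \<in> disk_algebra \<Longrightarrow> snorm (- a) = snorm a"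
  using snorm_scale[of a "-1"] by (simp add: op_scaleC_minus_one)

lemma snorm_minus_commute: "a \<in> disk_algebra \<Longrightarrow> b \<in> disk_algebra \<Longrightarrow> snorm (a - b) = snorm (b - a)"
  using snorm_uminus[of "a - b"] by (simp add: disk_algebra_diff)

lemma snorm_zero: "snorm 0 = 0"
  using snorm_scaleR[OF disk_algebra_zero, of 0] by simp

text \<open>
  The square of the seminorm of \<open>a - s * form b a * b\<close> is nonnegative for all real \<open>s\<close>. It is
  smallest at \<open>s = 1 / (snorm b)\<^sup>2\<close>, which gives the inequality; if \<open>snorm b = 0\<close>, it is affine in
  \<open>s\<close>, so its slope, a multiple of \<open>(cmod (form a b))\<^sup>2\<close>, vanishes.
\<close>
lemma form_norm_le:
  assumes a: "a \<in> disk_algebra" and b: "b \<in> disk_algebra"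
  shows "cmod (form a b) \<le> snorm a * snorm b"
proof -
  define z where "z = form a b"
  have expand: "0 \<le> (snorm a)\<^sup>2 - 2 * s * (cmod z)\<^sup>2 + s\<^sup>2 * (cmod z)\<^sup>2 * (snorm b)\<^sup>2" for s :: real
  proof -
    define t where "t = - of_real s * cnj z"
    have "0 \<le> (snorm (a + op_scaleC t b))\<^sup>2" by simp
    also have "\<dots> = (snorm a)\<^sup>2 + 2 * Re (t * z) + (cmod t * snorm b)\<^sup>2"
      by (simp add: snorm_add_power2 snorm_scale form_scale_right disk_algebra_scale a b z_def)
    also have "Re (t * z) = - (s * (cmod z)\<^sup>2)"
      unfolding cmod_power2 by (simp add: t_def power2_eq_square algebra_simps)
    also have "(cmod t * snorm b)\<^sup>2 = s\<^sup>2 * (cmod z)\<^sup>2 * (snorm b)\<^sup>2"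
      by (simp add: t_def norm_mult power_mult_distrib)
    finally show ?thesis by (simp add: algebra_simps)
  qed
  have "cmod z \<le> snorm a * snorm b"
  proof (cases "snorm b = 0")
    case True
    have "z = 0"
    proof (rule ccontr)
      assume "z \<noteq> 0"
      then have "2 * (((snorm a)\<^sup>2 + 1) / (2 * (cmod z)\<^sup>2)) * (cmod z)\<^sup>2 = (snorm a)\<^sup>2 + 1"
        by simp
      then show False
        using expand[of "((snorm a)\<^sup>2 + 1) / (2 * (cmod z)\<^sup>2)"] True by simp
    qed
    then show ?thesis using snorm_nonneg a b by simp
  next
    case False
    then have pos: "0 < (snorm b)\<^sup>2" by simp
    have "(1 / q)\<^sup>2 * w * q = w / q" if "0 < q" for q w :: real
      using that by (simp add: power2_eq_square)
    from this[OF pos] have "0 \<le> (snorm a)\<^sup>2 - (cmod z)\<^sup>2 / (snorm b)\<^sup>2"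
      using expand[of "1 / (snorm b)\<^sup>2"] by simp
    then have "(cmod z)\<^sup>2 \<le> (snorm a * snorm b)\<^sup>2"
      using pos by (simp add: pos_divide_le_eq power_mult_distrib)
    then show ?thesis by (rule power2_le_imp_le) (simp add: snorm_nonneg a b)
  qed
  then show ?thesis by (simp add: z_def)
qed

lemma snorm_triangle:
  assumes a: "a \<in> disk_algebra" and b: "b \<in> disk_algebra"
  shows "snorm (a + b) \<le> snorm a + snorm b"
proof (rule power2_le_imp_le)
  have "Re (form a b) \<le> snorm a * snorm b"
    using form_norm_le[OF a b] complex_Re_le_cmod order_trans by blast
  then show "(snorm (a + b))\<^sup>2 \<le> (snorm a + snorm b)\<^sup>2"
    by (simp add: snorm_add_power2[OF a b] power2_sum)
qed (simp add: snorm_nonneg a b)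

lemma snorm_triangle_mid:
  assumes "a \<in> disk_algebra" "b \<in> disk_algebra" "c \<in> disk_algebra"
  shows "snorm (a - c) \<le> snorm (a - b) + snorm (b - c)"
  using snorm_triangle[of "a - b" "b - c"] assms by (simp add: disk_algebra_diff)

section \<open>The completion\<close>

lemma gns_cauchyD: "X \<in> gns_cauchy \<mu> \<Longrightarrow> X n \<in> disk_algebra"
  unfolding gns_cauchy_def by blast

lemma gns_cauchyE:
  assumes "X \<in> gns_cauchy \<mu>" "0 < e"
  obtains N where "\<And>n k. n \<ge> N \<Longrightarrow> k \<ge> N \<Longrightarrow> snorm (X n - X k) < e"
  using assms unfolding gns_cauchy_def by blast

lemma gns_cauchyI:
  assumes "\<And>n. X n \<in> disk_algebra"
    and "\<And>e. 0 < e \<Longrightarrow> \<exists>N. \<forall>n\<ge>N. \<forall>k\<ge>N. snorm (X n - X k) < e"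
  shows "X \<in> gns_cauchy \<mu>"
  using assms unfolding gns_cauchy_def by blast

lemma gns_cauchy_const: "a \<in> disk_algebra \<Longrightarrow> (\<lambda>_. a) \<in> gns_cauchy \<mu>"
  by (rule gns_cauchyI) (simp_all add: snorm_zero)

lemma gns_cauchy_add:
  assumes X: "X \<in> gns_cauchy \<mu>" and Y: "Y \<in> gns_cauchy \<mu>"
  shows "(\<lambda>n. X n + Y n) \<in> gns_cauchy \<mu>"
proof (rule gns_cauchyI)
  show "X n + Y n \<in> disk_algebra" for n by (intro disk_algebra_add gns_cauchyD X Y)
  fix e :: real assume "0 < e"
  then have "0 < e / 2" by simp
  obtain M where M: "\<And>n k. n \<ge> M \<Longrightarrow> k \<ge> M \<Longrightarrow> snorm (X n - X k) < e / 2"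
    using gns_cauchyE[OF X \<open>0 < e / 2\<close>] by blast
  obtain N where N: "\<And>n k. n \<ge> N \<Longrightarrow> k \<ge> N \<Longrightarrow> snorm (Y n - Y k) < e / 2"
    using gns_cauchyE[OF Y \<open>0 < e / 2\<close>] by blast
  have "snorm (X n + Y n - (X k + Y k)) < e" if "n \<ge> max M N" "k \<ge> max M N" for n k
  proof -
    have "snorm (X n + Y n - (X k + Y k)) = snorm ((X n - X k) + (Y n - Y k))"
      by (simp add: algebra_simps)
    also have "\<dots> \<le> snorm (X n - X k) + snorm (Y n - Y k)"
      by (intro snorm_triangle disk_algebra_diff gns_cauchyD X Y)
    also have "\<dots> < e" using M[of n k] N[of n k] that by simp
    finally show ?thesis .
  qed
  then show "\<exists>N. \<forall>n\<ge>N. \<forall>k\<ge>N. snorm (X n + Y n - (X k + Y k)) < e" by blast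
qed

lemma gns_cauchy_scale:
  assumes X: "X \<in> gns_cauchy \<mu>"
  shows "(\<lambda>n. op_scaleC c (X n)) \<in> gns_cauchy \<mu>"
proof (rule gns_cauchyI)
  show "op_scaleC c (X n) \<in> disk_algebra" for n by (intro disk_algebra_scale gns_cauchyD X)
  fix e :: real assume "0 < e"
  then have "0 < e / (cmod c + 1)" by (simp add: add_nonneg_pos)
  then obtain N where N: "\<And>n k. n \<ge> N \<Longrightarrow> k \<ge> N \<Longrightarrow> snorm (X n - X k) < e / (cmod c + 1)"
    using gns_cauchyE[OF X] by blast
  have "snorm (op_scaleC c (X n) - op_scaleC c (X k)) < e" if "n \<ge> N" "k \<ge> N" for n k
  proof -
    have "snorm (op_scaleC c (X n) - op_scaleC c (X k)) = cmod c * snorm (X n - X k)"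
      by (simp add: snorm_scale disk_algebra_diff gns_cauchyD X flip: op_scaleC_diff)
    also have "\<dots> \<le> (cmod c + 1) * snorm (X n - X k)"
      by (intro mult_right_mono snorm_nonneg disk_algebra_diff gns_cauchyD X) simp
    also have "\<dots> < e"
      using N[OF that] pos_less_divide_eq[of "cmod c + 1" "snorm (X n - X k)" e]
      by (simp add: add_nonneg_pos mult.commute)
    finally show ?thesis .
  qed
  then show "\<exists>N. \<forall>n\<ge>N. \<forall>k\<ge>N. snorm (op_scaleC c (X n) - op_scaleC c (X k)) < e" by blast
qed

lemma gns_cauchy_bounded:
  assumes X: "X \<in> gns_cauchy \<mu>"
  obtains B where "0 < B" "\<And>n. snorm (X n) \<le> B"
proof -
  obtain N where N: "\<And>n k. n \<ge> N \<Longrightarrow> k \<ge> N \<Longrightarrow> snorm (X n - X k) < 1"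
    using gns_cauchyE[OF X, of 1] by auto
  define B where "B = 1 + (\<Sum>k\<le>N. snorm (X k))"
  have nn: "0 \<le> snorm (X k)" for k by (intro snorm_nonneg gns_cauchyD X)
  have le: "snorm (X n) \<le> (\<Sum>k\<le>N. snorm (X k))" if "n \<le> N" for n
    by (rule member_le_sum) (use that nn in auto)
  have bound: "snorm (X n) \<le> B" for n
  proof (cases "n \<le> N")
    case True
    then show ?thesis using le[of n] by (simp add: B_def)
  next
    case False
    have "snorm (X n) = snorm (X N + (X n - X N))" by simp
    also have "\<dots> \<le> snorm (X N) + snorm (X n - X N)"
      by (intro snorm_triangle disk_algebra_diff gns_cauchyD X)
    also have "\<dots> \<le> B" using le[of N] N[of n N] False by (simp add: B_def)
    finally show ?thesis .
  qed
  have "0 < B" unfolding B_def by (intro add_pos_nonneg sum_nonneg nn) simp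
  then show thesis using bound by (rule that)
qed

lemma gns_relD:
  "(X, Y) \<in> gns_rel \<mu> \<Longrightarrow> X \<in> gns_cauchy \<mu>"
  "(X, Y) \<in> gns_rel \<mu> \<Longrightarrow> Y \<in> gns_cauchy \<mu>"
  "(X, Y) \<in> gns_rel \<mu> \<Longrightarrow> (\<lambda>n. snorm (X n - Y n)) \<longlonglongrightarrow> 0"
  unfolding gns_rel_def by auto

lemma gns_relI:
  assumes "X \<in> gns_cauchy \<mu>" "Y \<in> gns_cauchy \<mu>" "(\<lambda>n. snorm (X n - Y n)) \<longlonglongrightarrow> 0"
  shows "(X, Y) \<in> gns_rel \<mu>"
  using assms unfolding gns_rel_def by auto

lemma snorm_tendsto_zeroI:
  assumes "f \<longlonglongrightarrow> 0" "\<And>n. a n \<in> disk_algebra" "\<And>n. snorm (a n) \<le> f n"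
  shows "(\<lambda>n. snorm (a n)) \<longlonglongrightarrow> 0"
  by (rule tendsto_sandwich[OF _ _ tendsto_const assms(1)])
     (use assms snorm_nonneg in auto)

lemma equiv_gns_rel: "equiv (gns_cauchy \<mu>) (gns_rel \<mu>)"
proof (rule equivI)
  show "gns_rel \<mu> \<subseteq> gns_cauchy \<mu> \<times> gns_cauchy \<mu>" using gns_relD by auto
  show "refl_on (gns_cauchy \<mu>) (gns_rel \<mu>)"
    by (rule refl_onI) (auto intro: gns_relI gns_relD simp: snorm_zero)
  show "sym (gns_rel \<mu>)"
    by (rule symI) (auto intro!: gns_relI dest: gns_relD simp: snorm_minus_commute gns_cauchyD gns_relD)
  show "trans (gns_rel \<mu>)"
  proof (rule transI)
    fix X Y Z assume XY: "(X, Y) \<in> gns_rel \<mu>" and YZ: "(Y, Z) \<in> gns_rel \<mu>"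
    note c = gns_relD(1)[OF XY] gns_relD(2)[OF XY] gns_relD(2)[OF YZ]
    show "(X, Z) \<in> gns_rel \<mu>"
    proof (rule gns_relI[OF c(1) c(3)], rule snorm_tendsto_zeroI)
      show "(\<lambda>n. snorm (X n - Y n) + snorm (Y n - Z n)) \<longlonglongrightarrow> 0"
        using tendsto_add[OF gns_relD(3)[OF XY] gns_relD(3)[OF YZ]] by simp
    qed (use c gns_cauchyD in \<open>auto intro: disk_algebra_diff snorm_triangle_mid\<close>)
  qed
qed

definition gns_class :: "(nat \<Rightarrow> 'd list op) \<Rightarrow> 'd gns"
  where "gns_class X = gns_rel \<mu> `` {X}"

lemma gns_embed_eq: "gns_embed \<mu> a = gns_class (\<lambda>_. a)"
  unfolding gns_embed_def gns_class_def ..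

lemma gns_class_mem: "X \<in> gns_cauchy \<mu> \<Longrightarrow> gns_class X \<in> gns_space \<mu>"
  unfolding gns_class_def gns_space_def by (rule quotientI)

lemma gns_spaceE:
  assumes "C \<in> gns_space \<mu>"
  obtains X where "X \<in> gns_cauchy \<mu>" "C = gns_class X"
  using assms unfolding gns_class_def gns_space_def by (rule quotientE)

lemma gns_class_eq_iff:
  "X \<in> gns_cauchy \<mu> \<Longrightarrow> Y \<in> gns_cauchy \<mu> \<Longrightarrow>
    gns_class X = gns_class Y \<longleftrightarrow> (\<lambda>n. snorm (X n - Y n)) \<longlonglongrightarrow> 0"
  unfolding gns_class_def eq_equiv_class_iff[OF equiv_gns_rel]
  by (auto intro: gns_relI dest: gns_relD)

lemma mem_gns_class:
  "X \<in> gns_cauchy \<mu> \<Longrightarrow>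
    Y \<in> gns_class X \<longleftrightarrow> Y \<in> gns_cauchy \<mu> \<and> (\<lambda>n. snorm (X n - Y n)) \<longlonglongrightarrow> 0"
  unfolding gns_class_def by (auto intro: gns_relI dest: gns_relD)

lemma gns_class_self: "X \<in> gns_cauchy \<mu> \<Longrightarrow> X \<in> gns_class X"
  by (simp add: mem_gns_class snorm_zero)

lemma gns_add_class:
  assumes X: "X \<in> gns_cauchy \<mu>" and Y: "Y \<in> gns_cauchy \<mu>"
  shows "gns_add \<mu> (gns_class X) (gns_class Y) = gns_class (\<lambda>n. X n + Y n)"
proof -
  have "gns_class (\<lambda>n. X' n + Y' n) = gns_class (\<lambda>n. X n + Y n)"
    if "X' \<in> gns_class X" "Y' \<in> gns_class Y" for X' Y'
  proof -
    note X' = that(1)[unfolded mem_gns_class[OF X]] and Y' = that(2)[unfolded mem_gns_class[OF Y]]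
    note c = gns_cauchyD[OF X] gns_cauchyD[OF Y] gns_cauchyD[of X'] gns_cauchyD[of Y']
    have "(\<lambda>n. snorm (X n + Y n - (X' n + Y' n))) \<longlonglongrightarrow> 0"
    proof (rule snorm_tendsto_zeroI)
      show "(\<lambda>n. snorm (X n - X' n) + snorm (Y n - Y' n)) \<longlonglongrightarrow> 0"
        using tendsto_add[OF conjunct2[OF X'] conjunct2[OF Y']] by simp
      show "snorm (X n + Y n - (X' n + Y' n)) \<le> snorm (X n - X' n) + snorm (Y n - Y' n)" for n
        using snorm_triangle[of "X n - X' n" "Y n - Y' n"] c X' Y'
        by (simp add: disk_algebra_diff algebra_simps)
    qed (use c X' Y' in \<open>auto intro!: disk_algebra_diff disk_algebra_add\<close>)
    then show ?thesis
      using gns_class_eq_iff[OF gns_cauchy_add[OF X Y] gns_cauchy_add[of X' Y']] X' Y' by simp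
  qed
  then have "gns_add \<mu> (gns_class X) (gns_class Y) =
      (\<Union>X'\<in>gns_class X. \<Union>Y'\<in>gns_class Y. gns_class (\<lambda>n. X n + Y n))"
    unfolding gns_add_def gns_class_def[of "\<lambda>n. _ n + _ n", symmetric] by (intro SUP_cong refl) 
  then show ?thesis using gns_class_self[OF X] gns_class_self[OF Y] by auto
qed

lemma gns_scale_class:
  assumes X: "X \<in> gns_cauchy \<mu>"
  shows "gns_scale \<mu> c (gns_class X) = gns_class (\<lambda>n. op_scaleC c (X n))"
proof -
  have "gns_class (\<lambda>n. op_scaleC c (X' n)) = gns_class (\<lambda>n. op_scaleC c (X n))"
    if "X' \<in> gns_class X" for X'
  proof -
    note X' = that[unfolded mem_gns_class[OF X]]
    have "(\<lambda>n. cmod c * snorm (X n - X' n)) \<longlonglongrightarrow> 0"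
      using X' tendsto_mult_right_zero by blast
    then have "(\<lambda>n. snorm (op_scaleC c (X n) - op_scaleC c (X' n))) \<longlonglongrightarrow> 0"
      using X X' by (simp add: snorm_scale disk_algebra_diff gns_cauchyD flip: op_scaleC_diff)
    then show ?thesis
      using gns_class_eq_iff[OF gns_cauchy_scale[OF X, of c] gns_cauchy_scale[of X' c]] X' by simp
  qed
  then have "gns_scale \<mu> c (gns_class X) =
      (\<Union>X'\<in>gns_class X. gns_class (\<lambda>n. op_scaleC c (X n)))"
    unfolding gns_scale_def gns_class_def[of "\<lambda>n. op_scaleC c (_ n)", symmetric]
    by (intro SUP_cong refl)
  then show ?thesis using gns_class_self[OF X] by auto
qed

lemma form_diff_le:
  assumes "a \<in> disk_algebra" "b \<in> disk_algebra" "c \<in> disk_algebra" "d \<in> disk_algebra"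
  shows "cmod (form a b - form c d) \<le> snorm (a - c) * snorm b + snorm c * snorm (b - d)"
proof -
  have "form a b - form c d = form (a - c) b + form c (b - d)"
    using assms by (simp add: form_diff_left form_diff_right)
  then show ?thesis
    using assms norm_triangle_ineq[of "form (a - c) b" "form c (b - d)"]
      form_norm_le[of "a - c" b] form_norm_le[of c "b - d"]
    by (simp add: disk_algebra_diff)
qed

text \<open>The form is uniformly continuous on seminorm-bounded sets, so it converges along pairs of Cauchy
  sequences, with a limit depending only on their classes.\<close>
lemma gns_inner_class:
  assumes X: "X \<in> gns_cauchy \<mu>" and Y: "Y \<in> gns_cauchy \<mu>"
  shows "(\<lambda>n. form (X n) (Y n)) \<longlonglongrightarrow> gns_inner \<mu> (gns_class X) (gns_class Y)"
proof -
  obtain B where B: "0 < B" "\<And>n. snorm (X n) \<le> B" using gns_cauchy_bounded[OF X] by blast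
  obtain D where D: "0 < D" "\<And>n. snorm (Y n) \<le> D" using gns_cauchy_bounded[OF Y] by blast
  note c = gns_cauchyD[OF X] gns_cauchyD[OF Y]
  have "Cauchy (\<lambda>n. form (X n) (Y n))"
  proof (rule CauchyI)
    fix e :: real assume "0 < e"
    obtain M where M: "\<And>n k. n \<ge> M \<Longrightarrow> k \<ge> M \<Longrightarrow> snorm (X n - X k) < e / (2 * D)"
      using gns_cauchyE[OF X, of "e / (2 * D)"] \<open>0 < e\<close> D(1) by auto
    obtain N where N: "\<And>n k. n \<ge> N \<Longrightarrow> k \<ge> N \<Longrightarrow> snorm (Y n - Y k) < e / (2 * B)"
      using gns_cauchyE[OF Y, of "e / (2 * B)"] \<open>0 < e\<close> B(1) by auto
    have "norm (form (X n) (Y n) - form (X k) (Y k)) < e" if "n \<ge> max M N" "k \<ge> max M N" for n k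
    proof -
      have "norm (form (X n) (Y n) - form (X k) (Y k))
          \<le> snorm (X n - X k) * snorm (Y n) + snorm (X k) * snorm (Y n - Y k)"
        by (rule form_diff_le) (rule c)+
      also have "\<dots> \<le> snorm (X n - X k) * D + B * snorm (Y n - Y k)"
        by (intro add_mono mult_left_mono mult_right_mono B D snorm_nonneg disk_algebra_diff c)
      also have "\<dots> < e / 2 + e / 2"
        by (intro add_strict_mono) (use M[of n k] N[of n k] that B D in \<open>simp_all add: field_simps\<close>)
      finally show ?thesis by simp
    qed
    then show "\<exists>M. \<forall>m\<ge>M. \<forall>n\<ge>M. norm (form (X m) (Y m) - form (X n) (Y n)) < e" by blast
  qed
  then obtain z where z: "(\<lambda>n. form (X n) (Y n)) \<longlonglongrightarrow> z"
    by (auto simp: Cauchy_convergent_iff convergent_def)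
  have *: "(\<lambda>n. form (X' n) (Y' n)) \<longlonglongrightarrow> z" if "X' \<in> gns_class X" "Y' \<in> gns_class Y" for X' Y'
  proof -
    note X' = that(1)[unfolded mem_gns_class[OF X]] and Y' = that(2)[unfolded mem_gns_class[OF Y]]
    note c' = gns_cauchyD[OF conjunct1[OF X']] gns_cauchyD[OF conjunct1[OF Y']]
    obtain D' where D': "0 < D'" "\<And>n. snorm (Y' n) \<le> D'" using gns_cauchy_bounded Y' by blast
    have "(\<lambda>n. form (X n) (Y n) - form (X' n) (Y' n)) \<longlonglongrightarrow> 0"
    proof (rule Lim_null_comparison)
      have "norm (form (X n) (Y n) - form (X' n) (Y' n)) \<le>
          norm (form (X n) (Y n) - form (X n) (Y' n)) + norm (form (X n) (Y' n) - form (X' n) (Y' n))" for n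
        by (rule norm_diff_triangle_le[OF order_refl order_refl])
      also have "\<dots> n \<le> snorm (X n) * snorm (Y n - Y' n) + snorm (X n - X' n) * snorm (Y' n)" for n
        using form_diff_le[of "X n" "Y n" "X n" "Y' n"] form_diff_le[of "X n" "Y' n" "X' n" "Y' n"] c c'
        by (simp add: snorm_zero)
      also have "\<dots> n \<le> B * snorm (Y n - Y' n) + snorm (X n - X' n) * D'" for n
        by (intro add_mono mult_left_mono mult_right_mono B D' snorm_nonneg disk_algebra_diff c c')
      finally show "\<forall>\<^sub>F n in sequentially. norm (form (X n) (Y n) - form (X' n) (Y' n)) \<le>
          B * snorm (Y n - Y' n) + snorm (X n - X' n) * D'" by simp
      show "(\<lambda>n. B * snorm (Y n - Y' n) + snorm (X n - X' n) * D') \<longlonglongrightarrow> 0"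
        by (rule tendsto_add_zero)
           (use X' Y' in \<open>auto intro: tendsto_mult_right_zero tendsto_mult_left_zero\<close>)
    qed
    from tendsto_diff[OF z this] show ?thesis by simp
  qed
  have "gns_inner \<mu> (gns_class X) (gns_class Y) = z"
    unfolding gns_inner_def
  proof (rule the_equality)
    show "w = z" if "\<forall>X'\<in>gns_class X. \<forall>Y'\<in>gns_class Y. (\<lambda>n. form (X' n) (Y' n)) \<longlonglongrightarrow> w" for w
      using that gns_class_self X Y z LIMSEQ_unique by blast
  qed (use * in blast)
  with z show ?thesis by simp
qed

end

section \<open>The canonical isometry\<close>

lemma nc_measure_lebesgue: "nc_measure nc_lebesgue"
  unfolding nc_measure_def nc_lebesgue_def positive_op_def
  by (simp add: blinfun.add_left cinner_add_right op_scaleC_apply cinner_scaleC_right)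

lemma nc_measure_add: "nc_measure \<mu> \<Longrightarrow> nc_measure \<nu> \<Longrightarrow> nc_measure (\<lambda>a. \<mu> a + \<nu> a)"
  unfolding nc_measure_def by (auto simp: algebra_simps intro: nonneg_Reals_add_I)

lemma gns_form_lebesgue:
  "a \<in> disk_algebra \<Longrightarrow> gns_form nc_lebesgue a b = cinner (a vac) (b vac)"
  unfolding gns_form_def nc_lebesgue_def by (simp add: cinner_adj adjointable_disk_algebra)

lemma tendsto_zero_eventually_less:
  fixes f :: "nat \<Rightarrow> real"
  assumes "f \<longlonglongrightarrow> 0" "0 < e"
  obtains N where "\<And>n. n \<ge> N \<Longrightarrow> f n < e"
  using order_tendstoD(2)[OF assms] unfolding eventually_sequentially by blast

context positive_nc_measure
begin

abbreviation \<nu> :: "'d list op \<Rightarrow> complex" where "\<nu> \<equiv> \<lambda>a. \<mu> a + nc_lebesgue a"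

interpretation sum: positive_nc_measure \<nu>
  by unfold_locales (intro nc_measure_add nc_measure nc_measure_lebesgue)

lemma sum_form: "a \<in> disk_algebra \<Longrightarrow> sum.form a b = form a b + cinner (a vac) (b vac)"
  using gns_form_lebesgue[of a b] by (simp add: gns_form_def)

lemma sum_snorm_power2:
  assumes a: "a \<in> disk_algebra"
  shows "(sum.snorm a)\<^sup>2 = (snorm a)\<^sup>2 + (norm (a vac))\<^sup>2"
proof -
  have "complex_of_real ((sum.snorm a)\<^sup>2) = of_real ((snorm a)\<^sup>2 + (norm (a vac))\<^sup>2)"
    using sum_form[OF a, of a] by (simp add: form_self sum.form_self cinner_self a)
  then show ?thesis by (simp only: of_real_eq_iff)
qed

lemma
  assumes a: "a \<in> disk_algebra"
  shows snorm_le_sum_snorm: "snorm a \<le> sum.snorm a"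
    and norm_vac_le_sum_snorm: "norm (a vac) \<le> sum.snorm a"
    and sum_snorm_le: "sum.snorm a \<le> snorm a + norm (a vac)"
proof -
  note nn = snorm_nonneg[OF a] sum.snorm_nonneg[OF a]
  show "snorm a \<le> sum.snorm a"
    by (rule power2_le_imp_le) (simp_all add: sum_snorm_power2 a nn)
  show "norm (a vac) \<le> sum.snorm a"
    by (rule power2_le_imp_le) (simp_all add: sum_snorm_power2 a nn)
  show "sum.snorm a \<le> snorm a + norm (a vac)"
    by (rule power2_le_imp_le) (simp_all add: sum_snorm_power2 a nn power2_sum)
qed

lemma sum_cauchy_imp_cauchy:
  assumes "X \<in> gns_cauchy \<nu>"
  shows "X \<in> gns_cauchy \<mu>"
proof (rule gns_cauchyI)
  show X: "X n \<in> disk_algebra" for n by (rule sum.gns_cauchyD[OF assms])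
  show "\<exists>N. \<forall>n\<ge>N. \<forall>k\<ge>N. snorm (X n - X k) < e" if e: "0 < e" for e
  proof -
    obtain N where N: "\<And>n k. n \<ge> N \<Longrightarrow> k \<ge> N \<Longrightarrow> sum.snorm (X n - X k) < e"
      using sum.gns_cauchyE[OF assms e] by blast
    have "snorm (X n - X k) < e" if "n \<ge> N" "k \<ge> N" for n k
      using snorm_le_sum_snorm[OF disk_algebra_diff[OF X X], of n k] N[OF that] by simp
    then show ?thesis by blast
  qed
qed

lemma sum_cauchy_imp_convergent:
  assumes "X \<in> gns_cauchy \<nu>"
  shows "convergent (\<lambda>n. X n vac)"
proof -
  have X: "X n \<in> disk_algebra" for n by (rule sum.gns_cauchyD[OF assms])
  have "Cauchy (\<lambda>n. X n vac)"
  proof (rule CauchyI)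
    fix e :: real assume e: "0 < e"
    obtain N where N: "\<And>n k. n \<ge> N \<Longrightarrow> k \<ge> N \<Longrightarrow> sum.snorm (X n - X k) < e"
      using sum.gns_cauchyE[OF assms e] by blast
    have "norm (X m vac - X n vac) < e" if "m \<ge> N" "n \<ge> N" for m n
      using norm_vac_le_sum_snorm[OF disk_algebra_diff[OF X X], of m n] N[OF that]
      by (simp add: blinfun.diff_left)
    then show "\<exists>M. \<forall>m\<ge>M. \<forall>n\<ge>M. norm (X m vac - X n vac) < e" by blast
  qed
  then show ?thesis by (simp add: Cauchy_convergent_iff)
qed

lemma sum_cauchyI:
  assumes X: "X \<in> gns_cauchy \<mu>" and lim: "(\<lambda>n. X n vac) \<longlonglongrightarrow> h"
  shows "X \<in> gns_cauchy \<nu>"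
proof (rule sum.gns_cauchyI)
  show mem: "X n \<in> disk_algebra" for n by (rule gns_cauchyD[OF X])
  fix e :: real assume "0 < e"
  then have e: "0 < e / 2" by simp
  obtain M where M: "\<And>n k. n \<ge> M \<Longrightarrow> k \<ge> M \<Longrightarrow> snorm (X n - X k) < e / 2"
    using gns_cauchyE[OF X e] by blast
  obtain N where N: "\<And>n k. n \<ge> N \<Longrightarrow> k \<ge> N \<Longrightarrow> norm (X n vac - X k vac) < e / 2"
    using CauchyD[OF LIMSEQ_imp_Cauchy[OF lim] e] by blast
  have "sum.snorm (X n - X k) < e" if "n \<ge> max M N" "k \<ge> max M N" for n k
    using sum_snorm_le[OF disk_algebra_diff[OF mem mem], of n k] M[of n k] N[of n k] that
    by (simp add: blinfun.diff_left)
  then show "\<exists>N. \<forall>n\<ge>N. \<forall>k\<ge>N. sum.snorm (X n - X k) < e" by blast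
qed

text \<open>The value is computed from an arbitrary representative, as both components depend on its class
  only.\<close>
definition canonical_map :: "'d gns \<Rightarrow> 'd gns \<times> 'd list ell2" where
  "canonical_map C =
     (let X = SOME X. X \<in> gns_cauchy \<nu> \<and> C = sum.gns_class X in (gns_class X, lim (\<lambda>n. X n vac)))"

lemma canonical_map_class:
  assumes X: "X \<in> gns_cauchy \<nu>" and lim: "(\<lambda>n. X n vac) \<longlonglongrightarrow> h"
  shows "canonical_map (sum.gns_class X) = (gns_class X, h)"
proof -
  define Y where "Y = (SOME Y. Y \<in> gns_cauchy \<nu> \<and> sum.gns_class X = sum.gns_class Y)"
  have Y: "Y \<in> gns_cauchy \<nu>" "sum.gns_class X = sum.gns_class Y"
    using someI[of "\<lambda>Y. Y \<in> gns_cauchy \<nu> \<and> sum.gns_class X = sum.gns_class Y" X] X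
    by (simp_all add: Y_def)
  have mem: "X n \<in> disk_algebra" "Y n \<in> disk_algebra" for n
    using X Y by (simp_all add: sum.gns_cauchyD)
  have XY: "(\<lambda>n. sum.snorm (X n - Y n)) \<longlonglongrightarrow> 0"
    using sum.gns_class_eq_iff[OF X Y(1)] Y(2) by simp
  have "(\<lambda>n. snorm (X n - Y n)) \<longlonglongrightarrow> 0"
    by (rule snorm_tendsto_zeroI[OF XY]) (intro disk_algebra_diff mem snorm_le_sum_snorm)+
  then have 1: "gns_class X = gns_class Y"
    using gns_class_eq_iff X Y(1) sum_cauchy_imp_cauchy by simp
  have "(\<lambda>n. X n vac - Y n vac) \<longlonglongrightarrow> 0"
  proof (rule Lim_null_comparison[OF _ XY])
    show "\<forall>\<^sub>F n in sequentially. norm (X n vac - Y n vac) \<le> sum.snorm (X n - Y n)"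
      using norm_vac_le_sum_snorm[OF disk_algebra_diff[OF mem]] by (simp add: blinfun.diff_left)
  qed
  from tendsto_diff[OF lim this] have "(\<lambda>n. Y n vac) \<longlonglongrightarrow> h" by simp
  then have "lim (\<lambda>n. Y n vac) = h" by (rule limI)
  with 1 show ?thesis unfolding canonical_map_def Let_def Y_def[symmetric] by simp
qed

lemma sum_gns_spaceE:
  assumes "C \<in> gns_space \<nu>"
  obtains X h where "X \<in> gns_cauchy \<nu>" "(\<lambda>n. X n vac) \<longlonglongrightarrow> h" "C = sum.gns_class X"
    "canonical_map C = (gns_class X, h)"
proof -
  obtain X where X: "X \<in> gns_cauchy \<nu>" "C = sum.gns_class X" by (rule sum.gns_spaceE[OF assms])
  obtain h where h: "(\<lambda>n. X n vac) \<longlonglongrightarrow> h"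
    using sum_cauchy_imp_convergent[OF X(1)] by (auto simp: convergent_def)
  show thesis using that[OF X(1) h X(2)] canonical_map_class[OF X(1) h] X(2) by simp
qed

lemma gns_canonical_isometry_canonical_map: "gns_canonical_isometry \<mu> canonical_map"
  unfolding gns_canonical_isometry_def Let_def
proof (intro conjI ballI allI)
  show "canonical_map ` gns_space \<nu> \<subseteq> gns_space \<mu> \<times> UNIV"
    by (auto elim!: sum_gns_spaceE simp: gns_class_mem sum_cauchy_imp_cauchy)
next
  fix C D assume C: "C \<in> gns_space \<nu>" and D: "D \<in> gns_space \<nu>"
  obtain X h where X: "X \<in> gns_cauchy \<nu>" "(\<lambda>n. X n vac) \<longlonglongrightarrow> h" "C = sum.gns_class X"
    "canonical_map C = (gns_class X, h)" by (rule sum_gns_spaceE[OF C])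
  obtain Y k where Y: "Y \<in> gns_cauchy \<nu>" "(\<lambda>n. Y n vac) \<longlonglongrightarrow> k" "D = sum.gns_class Y"
    "canonical_map D = (gns_class Y, k)" by (rule sum_gns_spaceE[OF D])
  note \<mu>X = sum_cauchy_imp_cauchy[OF X(1)] and \<mu>Y = sum_cauchy_imp_cauchy[OF Y(1)]
  have "(\<lambda>n. (X n + Y n) vac) \<longlonglongrightarrow> h + k"
    using tendsto_add[OF X(2) Y(2)] by (simp add: blinfun.add_left)
  from canonical_map_class[OF sum.gns_cauchy_add[OF X(1) Y(1)] this]
  show "canonical_map (gns_add \<nu> C D) =
      (gns_add \<mu> (fst (canonical_map C)) (fst (canonical_map D)),
       snd (canonical_map C) + snd (canonical_map D))"
    unfolding X(4) Y(4) unfolding X(3) Y(3)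
    by (simp add: sum.gns_add_class[OF X(1) Y(1)] gns_add_class[OF \<mu>X \<mu>Y])
  have "gns_inner \<nu> C D = gns_inner \<mu> (gns_class X) (gns_class Y) + cinner h k"
    unfolding X(3) Y(3)
  proof (rule LIMSEQ_unique[OF sum.gns_inner_class[OF X(1) Y(1)]])
    show "(\<lambda>n. sum.form (X n) (Y n))
        \<longlonglongrightarrow> gns_inner \<mu> (gns_class X) (gns_class Y) + cinner h k"
      unfolding sum_form[OF sum.gns_cauchyD[OF X(1)]]
      by (intro tendsto_intros gns_inner_class \<mu>X \<mu>Y X Y)
  qed
  then show "gns_inner \<mu> (fst (canonical_map C)) (fst (canonical_map D)) +
      cinner (snd (canonical_map C)) (snd (canonical_map D)) = gns_inner \<nu> C D"
    by (simp add: X(4) Y(4))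
next
  fix c C assume C: "C \<in> gns_space \<nu>"
  obtain X h where X: "X \<in> gns_cauchy \<nu>" "(\<lambda>n. X n vac) \<longlonglongrightarrow> h" "C = sum.gns_class X"
    "canonical_map C = (gns_class X, h)" by (rule sum_gns_spaceE[OF C])
  have "(\<lambda>n. op_scaleC c (X n) vac) \<longlonglongrightarrow> c *\<^sub>C h"
    using tendsto_scaleC[OF X(2)] by (simp add: op_scaleC_apply)
  from canonical_map_class[OF sum.gns_cauchy_scale[OF X(1)] this]
  show "canonical_map (gns_scale \<nu> c C) =
      (gns_scale \<mu> c (fst (canonical_map C)), c *\<^sub>C snd (canonical_map C))"
    unfolding X(4) unfolding X(3)
    by (simp add: sum.gns_scale_class[OF X(1)] gns_scale_class[OF sum_cauchy_imp_cauchy[OF X(1)]])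
next
  fix a :: "'d list op" assume a: "a \<in> disk_algebra"
  show "canonical_map (gns_embed \<nu> a) = (gns_embed \<mu> a, a vac)"
    unfolding sum.gns_embed_eq gns_embed_eq
    by (rule canonical_map_class[OF sum.gns_cauchy_const[OF a] tendsto_const])
qed

text \<open>
  This is density of the pairs \<open>(a, a 1)\<close> in the direct sum: the closure of their range contains all
  pairs \<open>(a, 0)\<close>, hence by subtraction all \<open>(0, a 1)\<close>, and these two families span a dense subspace.
\<close>
definition vanishing_approximation :: bool where
  "vanishing_approximation \<longleftrightarrow>
     (\<forall>a\<in>disk_algebra. \<forall>e>0. \<exists>y\<in>disk_algebra. norm ((y :: 'd list op) vac) < e \<and> snorm (a - y) < e)"

text \<open>
  Given a Cauchy sequence \<open>Y\<close> for \<open>\<mu>\<close> and a vector \<open>h\<close>, choose \<open>Z n\<close> in the algebra whose vectors tend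
  to \<open>h\<close>, and correct it by an element approximating \<open>Y n - Z n\<close> whose vector is negligible.
\<close>
lemma canonical_map_onto:
  assumes *: vanishing_approximation
  shows "canonical_map ` gns_space \<nu> = gns_space \<mu> \<times> UNIV"
proof
  show "canonical_map ` gns_space \<nu> \<subseteq> gns_space \<mu> \<times> UNIV"
    using gns_canonical_isometry_canonical_map unfolding gns_canonical_isometry_def Let_def by blast
  show "gns_space \<mu> \<times> UNIV \<subseteq> canonical_map ` gns_space \<nu>"
  proof clarify
    fix K and h :: "'d list ell2" assume "K \<in> gns_space \<mu>"
    then obtain Y where Y: "Y \<in> gns_cauchy \<mu>" "K = gns_class Y" by (rule gns_spaceE)
    define e :: "nat \<Rightarrow> real" where "e n = inverse (real (Suc n))" for n
    have e: "0 < e n" for n by (simp add: e_def)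
    have e0: "e \<longlonglongrightarrow> 0" unfolding e_def by (rule LIMSEQ_inverse_real_of_nat)
    have "\<exists>z\<in>disk_algebra. norm (h - (z :: 'd list op) vac) < e n" for n
      using disk_vecs_approx[OF e] by metis
    then obtain Z where Z: "\<And>n. Z n \<in> disk_algebra" "\<And>n. norm (h - Z n vac) < e n" by metis
    have "\<exists>y\<in>disk_algebra. norm ((y :: 'd list op) vac) < e n \<and> snorm (Y n - Z n - y) < e n" for n
      using * e disk_algebra_diff[OF gns_cauchyD[OF Y(1)] Z(1)]
      unfolding vanishing_approximation_def by blast
    then obtain y where y: "\<And>n. y n \<in> disk_algebra" "\<And>n. norm (y n vac) < e n"
      "\<And>n. snorm (Y n - Z n - y n) < e n" by metis
    define X where "X n = Z n + y n" for n
    have mem: "X n \<in> disk_algebra" "Y n \<in> disk_algebra" for n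
      unfolding X_def by (intro disk_algebra_add Z y gns_cauchyD Y)+
    have "(\<lambda>n. X n vac - h) \<longlonglongrightarrow> 0"
    proof (rule Lim_null_comparison)
      show "(\<lambda>n. e n + e n) \<longlonglongrightarrow> 0" using tendsto_add[OF e0 e0] by simp
      have "norm (X n vac - h) \<le> e n + e n" for n
        using norm_triangle_ineq4[of "y n vac" "h - Z n vac"] y(2)[of n] Z(2)[of n]
        by (simp add: X_def blinfun.add_left algebra_simps)
      then show "\<forall>\<^sub>F n in sequentially. norm (X n vac - h) \<le> e n + e n" by simp
    qed
    then have lim: "(\<lambda>n. X n vac) \<longlonglongrightarrow> h" by (simp add: LIM_zero_iff)
    have YX: "(\<lambda>n. snorm (Y n - X n)) \<longlonglongrightarrow> 0"
    proof (rule snorm_tendsto_zeroI[OF e0])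
      show "snorm (Y n - X n) \<le> e n" for n
        using y(3)[of n] by (simp add: X_def algebra_simps)
    qed (intro disk_algebra_diff mem)
    have X: "X \<in> gns_cauchy \<mu>"
    proof (rule gns_cauchyI)
      show "X n \<in> disk_algebra" for n by (rule mem)
      fix r :: real assume r: "0 < r"
      from r have r3: "0 < r / 3" by simp
      obtain M where M: "\<And>n k. n \<ge> M \<Longrightarrow> k \<ge> M \<Longrightarrow> snorm (Y n - Y k) < r / 3"
        using gns_cauchyE[OF Y(1) r3] by blast
      obtain N where N: "\<And>n. n \<ge> N \<Longrightarrow> snorm (Y n - X n) < r / 3"
        using tendsto_zero_eventually_less[OF YX r3] by blast
      have "snorm (X n - X k) < r" if "n \<ge> max M N" "k \<ge> max M N" for n k
      proof -
        have "snorm (X n - X k) \<le> snorm (X n - Y n) + snorm (Y n - X k)"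
          by (intro snorm_triangle_mid mem)
        also have "snorm (Y n - X k) \<le> snorm (Y n - Y k) + snorm (Y k - X k)"
          by (intro snorm_triangle_mid mem)
        finally show ?thesis
          using M[of n k] N[of n] N[of k] that snorm_minus_commute[OF mem, of n n] by linarith
      qed
      then show "\<exists>N. \<forall>n\<ge>N. \<forall>k\<ge>N. snorm (X n - X k) < r" by blast
    qed
    note \<nu>X = sum_cauchyI[OF X lim]
    have "gns_class Y = gns_class X" unfolding gns_class_eq_iff[OF Y(1) X] by (rule YX)
    then have "(K, h) = canonical_map (sum.gns_class X)"
      by (simp only: canonical_map_class[OF \<nu>X lim] Y(2))
    then show "(K, h) \<in> canonical_map ` gns_space \<nu>"
      using sum.gns_class_mem[OF \<nu>X] by (rule image_eqI)
  qed
qed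

text \<open>
  A preimage of \<open>(a, 0)\<close> is the class of some \<open>X\<close>. By isometry, the distance of the image
  of a late term \<open>X N\<close> from \<open>(a, 0)\<close> is the distance of \<open>X N\<close> from the class of \<open>X\<close>.
\<close>
lemma vanishing_approximation_if_onto:
  assumes V: "gns_canonical_isometry \<mu> V" and onto: "V ` gns_space \<nu> = gns_space \<mu> \<times> UNIV"
  shows vanishing_approximation
  unfolding vanishing_approximation_def
proof (intro ballI allI impI)
  fix a :: "'d list op" and e :: real
  assume a: "a \<in> disk_algebra" and e: "0 < e"
  have "(gns_embed \<mu> a, 0) \<in> V ` gns_space \<nu>"
    unfolding onto gns_embed_eq by (simp add: gns_class_mem gns_cauchy_const a)
  then obtain C where C: "V C = (gns_embed \<mu> a, 0)" "C \<in> gns_space \<nu>"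
    unfolding image_iff by (blast dest: sym)
  obtain X where X: "X \<in> gns_cauchy \<nu>" "C = sum.gns_class X" by (rule sum.gns_spaceE[OF C(2)])
  from e have e2: "0 < e / 2" by simp
  obtain N where N: "\<And>n k. n \<ge> N \<Longrightarrow> k \<ge> N \<Longrightarrow> sum.snorm (X n - X k) < e / 2"
    using sum.gns_cauchyE[OF X(1) e2] by blast
  define y where "y = X N"
  have y: "y \<in> disk_algebra" unfolding y_def by (rule sum.gns_cauchyD[OF X(1)])
  define D where "D = gns_scale \<nu> (-1) (gns_embed \<nu> y)"
  have D_eq: "D = sum.gns_class (\<lambda>_. - y)"
    unfolding D_def sum.gns_embed_eq
    by (simp add: sum.gns_scale_class sum.gns_cauchy_const y op_scaleC_minus_one)
  have D: "D \<in> gns_space \<nu>"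
    unfolding D_eq by (intro sum.gns_class_mem sum.gns_cauchy_const disk_algebra_uminus y)
  have emb: "gns_embed \<nu> y \<in> gns_space \<nu>"
    unfolding sum.gns_embed_eq by (intro sum.gns_class_mem sum.gns_cauchy_const y)
  have V_embed: "V (gns_embed \<nu> y) = (gns_embed \<mu> y, y vac)"
    using V y unfolding gns_canonical_isometry_def Let_def by blast
  have "V D = (gns_scale \<mu> (-1) (fst (V (gns_embed \<nu> y))), (-1) *\<^sub>C snd (V (gns_embed \<nu> y)))"
    using V emb unfolding D_def gns_canonical_isometry_def Let_def by blast
  also have "\<dots> = (gns_scale \<mu> (-1) (gns_embed \<mu> y), (-1) *\<^sub>C y vac)"
    by (simp add: V_embed)
  also have "\<dots> = (gns_class (\<lambda>_. - y), - y vac)"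
    unfolding gns_embed_eq
    by (simp add: gns_scale_class gns_cauchy_const y op_scaleC_minus_one scaleC_minus_one)
  finally have VD: "V D = (gns_class (\<lambda>_. - y), - y vac)" .
  define W where "W = (\<lambda>n. X n - y)"
  have W: "W \<in> gns_cauchy \<nu>" "gns_add \<nu> C D = sum.gns_class W"
    unfolding W_def X(2) D_eq
    using sum.gns_cauchy_add[OF X(1) sum.gns_cauchy_const[OF disk_algebra_uminus[OF y]]]
      sum.gns_add_class[OF X(1) sum.gns_cauchy_const[OF disk_algebra_uminus[OF y]]]
    by simp_all
  have CD: "gns_add \<nu> C D \<in> gns_space \<nu>" unfolding W(2) by (rule sum.gns_class_mem[OF W(1)])
  have "V (gns_add \<nu> C D) = (gns_add \<mu> (fst (V C)) (fst (V D)), snd (V C) + snd (V D))"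
    using V C(2) D unfolding gns_canonical_isometry_def Let_def by blast
  also have "\<dots> = (gns_add \<mu> (gns_embed \<mu> a) (gns_class (\<lambda>_. - y)), 0 + - y vac)"
    by (simp add: C(1) VD)
  also have "\<dots> = (gns_class (\<lambda>_. a - y), - y vac)"
    unfolding gns_embed_eq by (simp add: gns_add_class gns_cauchy_const a y disk_algebra_uminus)
  finally have VW: "V (gns_add \<nu> C D) = (gns_class (\<lambda>_. a - y), - y vac)" .
  have "gns_inner \<mu> (fst (V (gns_add \<nu> C D))) (fst (V (gns_add \<nu> C D))) +
      cinner (snd (V (gns_add \<nu> C D))) (snd (V (gns_add \<nu> C D))) =
      gns_inner \<nu> (gns_add \<nu> C D) (gns_add \<nu> C D)"
    using V CD unfolding gns_canonical_isometry_def Let_def by blast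
  then have iso: "gns_inner \<mu> (gns_class (\<lambda>_. a - y)) (gns_class (\<lambda>_. a - y)) +
      cinner (- y vac) (- y vac) = gns_inner \<nu> (sum.gns_class W) (sum.gns_class W)"
    unfolding VW by (simp add: W(2))
  have ay: "a - y \<in> disk_algebra" by (intro disk_algebra_diff a y)
  have "gns_inner \<mu> (gns_class (\<lambda>_. a - y)) (gns_class (\<lambda>_. a - y)) = form (a - y) (a - y)"
    using LIMSEQ_unique[OF gns_inner_class[OF gns_cauchy_const[OF ay] gns_cauchy_const[OF ay]]
        tendsto_const] .
  with iso have val: "gns_inner \<nu> (sum.gns_class W) (sum.gns_class W) =
      of_real ((snorm (a - y))\<^sup>2 + (norm (y vac))\<^sup>2)"
    by (simp add: form_self ay cinner_self)
  have "(snorm (a - y))\<^sup>2 + (norm (y vac))\<^sup>2 \<le> (e / 2)\<^sup>2"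
  proof (rule LIMSEQ_le_const2)
    have "(\<lambda>n. Re (sum.form (W n) (W n))) \<longlonglongrightarrow> Re (gns_inner \<nu> (sum.gns_class W) (sum.gns_class W))"
      by (intro tendsto_Re sum.gns_inner_class W)
    then show "(\<lambda>n. (sum.snorm (W n))\<^sup>2) \<longlonglongrightarrow> (snorm (a - y))\<^sup>2 + (norm (y vac))\<^sup>2"
      unfolding val by (simp add: sum.form_self sum.gns_cauchyD[OF W(1)] del: of_real_power of_real_add)
    have "(sum.snorm (W n))\<^sup>2 \<le> (e / 2)\<^sup>2" if "n \<ge> N" for n
      using N[of n N] that sum.snorm_nonneg[OF sum.gns_cauchyD[OF W(1)], of n]
      by (intro power_mono) (simp_all add: W_def y_def)
    then show "\<exists>N. \<forall>n\<ge>N. (sum.snorm (W n))\<^sup>2 \<le> (e / 2)\<^sup>2" by blast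
  qed
  then have "(norm (y vac))\<^sup>2 \<le> (e / 2)\<^sup>2" "(snorm (a - y))\<^sup>2 \<le> (e / 2)\<^sup>2"
    using zero_le_power2[of "snorm (a - y)"] zero_le_power2[of "norm (y vac)"] by linarith+
  then have "norm (y vac) \<le> e / 2" "snorm (a - y) \<le> e / 2"
    using e2 by (meson power2_le_imp_le less_imp_le)+
  then show "\<exists>y\<in>disk_algebra. norm ((y :: 'd list op) vac) < e \<and> snorm (a - y) < e"
    using y e by (intro bexI[of _ y]) auto
qed

section \<open>Singularity\<close>

lemma psd_formD:
  assumes "psd_form (D, q)"
  shows "x \<in> D \<Longrightarrow> y \<in> D \<Longrightarrow> x + y \<in> D" "x \<in> D \<Longrightarrow> c *\<^sub>C x \<in> D"
    "x \<in> D \<Longrightarrow> y \<in> D \<Longrightarrow> z \<in> D \<Longrightarrow> q (x + y) z = q x z + q y z"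
    "x \<in> D \<Longrightarrow> y \<in> D \<Longrightarrow> z \<in> D \<Longrightarrow> q z (x + y) = q z x + q z y"
    "x \<in> D \<Longrightarrow> y \<in> D \<Longrightarrow> q (c *\<^sub>C x) y = cnj c * q x y"
    "x \<in> D \<Longrightarrow> y \<in> D \<Longrightarrow> q x (c *\<^sub>C y) = c * q x y"
    "x \<in> D \<Longrightarrow> q x x \<in> \<real>\<^sub>\<ge>\<^sub>0"
  using assms unfolding psd_form_def by auto

lemma psd_form_parallelogram:
  assumes q: "psd_form (D, q)" and x: "x \<in> D" and y: "y \<in> D"
  shows "Re (q (x + y) (x + y)) \<le> 2 * Re (q x x) + 2 * Re (q y y)"
proof -
  note qD = psd_formD[OF q]
  have my: "(-1) *\<^sub>C y \<in> D" by (rule qD(2)[OF y])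
  have "q (x + y) (x + y) + q (x + (-1) *\<^sub>C y) (x + (-1) *\<^sub>C y) = 2 * q x x + 2 * q y y"
    by (simp add: qD(1,3-6) x y my)
  then have "Re (q (x + y) (x + y) + q (x + (-1) *\<^sub>C y) (x + (-1) *\<^sub>C y)) = Re (2 * q x x + 2 * q y y)"
    by (rule arg_cong)
  then have "Re (q (x + y) (x + y)) + Re (q (x + (-1) *\<^sub>C y) (x + (-1) *\<^sub>C y))
      = 2 * Re (q x x) + 2 * Re (q y y)" by simp
  moreover have "0 \<le> Re (q (x + (-1) *\<^sub>C y) (x + (-1) *\<^sub>C y))"
    using qD(7)[OF qD(1)[OF x my]] by (simp add: complex_nonneg_Reals_iff)
  ultimately show ?thesis by linarith
qed

text \<open>
  If the maximal closable part vanishes, it forces every closable form below that of \<open>\<mu>\<close> to vanish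
  on \<open>disk_vecs\<close>; conversely, if all of these vanish there, the zero form with that domain is the
  greatest of them.
\<close>
lemma nc_singular_iff:
  "nc_singular \<mu> \<longleftrightarrow>
    (\<forall>D r. psd_form (D, r) \<and> closable_form (D, r) \<and> form_le (D, r) (nc_form \<mu>) \<longrightarrow>
      (\<forall>x\<in>disk_vecs. r x x = 0))" (is "_ \<longleftrightarrow> ?R")
proof
  assume "nc_singular \<mu>"
  then obtain p where p: "is_form_ac (nc_form \<mu>) p" "\<forall>x\<in>fst p. \<forall>y\<in>fst p. snd p x y = 0"
    unfolding nc_singular_def by blast
  obtain D' p' where pp: "p = (D', p')" by (cases p)
  have D': "D' = disk_vecs" using p(1) unfolding is_form_ac_def nc_form_def pp by simp
  show ?R
  proof (intro allI impI ballI)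
    fix D r and x :: "'d list ell2"
    assume r: "psd_form (D, r) \<and> closable_form (D, r) \<and> form_le (D, r) (nc_form \<mu>)"
      and x: "x \<in> disk_vecs"
    then have le: "form_le (D, r) p" using p(1) unfolding is_form_ac_def by blast
    have "x \<in> D" "Re (r x x) \<le> 0"
      using le p(2) x unfolding form_le_def pp D' by auto
    then show "r x x = 0"
      using psd_formD(7)[of D r x] r by (auto simp: complex_nonneg_Reals_iff complex_eq_iff)
  qed
next
  assume R: ?R
  let ?z = "(disk_vecs, \<lambda>_ _. 0) :: 'd list form"
  have "psd_form ?z"
    unfolding psd_form_def
    by (auto intro: disk_vecs_zero disk_vecs_add disk_vecs_scale simp: closure_disk_vecs)
  moreover have "closable_form ?z" unfolding closable_form_def by simp
  moreover have "form_le ?z (nc_form \<mu>)"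
    unfolding form_le_def nc_form_def disk_vecs_def
    by (auto simp: vec_op_vac form_self simp del: of_real_power)
  moreover have "form_le r ?z" if "psd_form r \<and> closable_form r \<and> form_le r (nc_form \<mu>)" for r
  proof -
    obtain D r' where r: "r = (D, r')" by (cases r)
    from R that have "\<forall>x\<in>disk_vecs. r' x x = 0" unfolding r by blast
    moreover have "disk_vecs \<subseteq> D" using that unfolding r form_le_def nc_form_def by auto
    ultimately show ?thesis unfolding r form_le_def by auto
  qed
  ultimately have "is_form_ac (nc_form \<mu>) ?z"
    unfolding is_form_ac_def by (auto simp: nc_form_def)
  then show "nc_singular \<mu>" unfolding nc_singular_def by force
qed

lemma form_le_nc_formD:
  assumes "form_le (D, r) (nc_form \<mu>)" "a \<in> disk_algebra"
  shows "a vac \<in> D" "Re (r (a vac) (a vac)) \<le> (snorm a)\<^sup>2"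
  using assms unfolding form_le_def nc_form_def disk_vecs_def
  by (auto simp: vec_op_vac form_self simp del: of_real_power)

text \<open>
  If \<open>a\<close> is approximated in \<open>\<mu>\<close>-seminorm by elements \<open>y n\<close> whose vectors tend to zero, then
  closability makes a form below that of \<open>\<mu>\<close> tend to zero along \<open>y n\<close>, while it tends to its
  value at \<open>a\<close>.
\<close>
lemma singular_if_vanishing_approximation:
  assumes *: vanishing_approximation
  shows "nc_singular \<mu>"
  unfolding nc_singular_iff
proof (intro allI impI ballI, elim conjE)
  fix D r and x :: "'d list ell2"
  assume psd: "psd_form (D, r)" and cl: "closable_form (D, r)"
    and le: "form_le (D, r) (nc_form \<mu>)" and x: "x \<in> disk_vecs"
  from x obtain a where a: "a \<in> disk_algebra" and xa: "x = a vac" unfolding disk_vecs_def by blast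
  define e :: "nat \<Rightarrow> real" where "e n = inverse (real (Suc n))" for n
  have e: "0 < e n" for n by (simp add: e_def)
  have e0: "e \<longlonglongrightarrow> 0" unfolding e_def by (rule LIMSEQ_inverse_real_of_nat)
  have "\<exists>y\<in>disk_algebra. norm ((y :: 'd list op) vac) < e n \<and> snorm (a - y) < e n" for n
    using * a e[of n] unfolding vanishing_approximation_def by blast
  then obtain y where y: "\<And>n. y n \<in> disk_algebra" "\<And>n. norm (y n vac) < e n"
    "\<And>n. snorm (a - y n) < e n" by metis
  note leD = form_le_nc_formD[OF le]
  have r_nonneg: "0 \<le> Re (r z z)" "cmod (r z z) = Re (r z z)" if "z \<in> D" for z
    using psd_formD(7)[OF psd that] by (auto simp: complex_nonneg_Reals_iff cmod_eq_Re)
  have lim: "(\<lambda>n. y n vac) \<longlonglongrightarrow> 0"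
    by (rule Lim_null_comparison[OF _ e0]) (use y(2) in \<open>simp add: less_imp_le\<close>)
  have "\<exists>N. \<forall>n\<ge>N. \<forall>k\<ge>N. cmod (r (y n vac - y k vac) (y n vac - y k vac)) < t" if "0 < t" for t
  proof -
    have t2: "0 < sqrt t / 2" using that by simp
    obtain N where N: "\<And>n. n \<ge> N \<Longrightarrow> e n < sqrt t / 2"
      using tendsto_zero_eventually_less[OF e0 t2] by blast
    have "cmod (r (y n vac - y k vac) (y n vac - y k vac)) < t" if "n \<ge> N" "k \<ge> N" for n k
    proof -
      have d: "y n - y k \<in> disk_algebra" by (intro disk_algebra_diff y)
      have "cmod (r (y n vac - y k vac) (y n vac - y k vac)) \<le> (snorm (y n - y k))\<^sup>2"
        using leD[OF d] r_nonneg by (simp add: blinfun.diff_left)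
      also have "snorm (y n - y k) < sqrt t"
        using snorm_triangle_mid[OF y(1) a y(1), of n k] snorm_minus_commute[OF y(1) a, of n]
          y(3)[of n] y(3)[of k] N[OF that(1)] N[OF that(2)] by linarith
      then have "(snorm (y n - y k))\<^sup>2 < (sqrt t)\<^sup>2"
        by (intro power_strict_mono) (simp_all add: snorm_nonneg d)
      also have "(sqrt t)\<^sup>2 = t" using \<open>0 < t\<close> by simp
      finally show ?thesis .
    qed
    then show ?thesis by blast
  qed
  with cl lim leD(1)[OF y(1)] have r0: "(\<lambda>n. r (y n vac) (y n vac)) \<longlonglongrightarrow> 0"
    unfolding closable_form_def by auto
  have "Re (r x x) \<le> 0"
  proof (rule LIMSEQ_le_const)
    show "(\<lambda>n. 2 * (e n)\<^sup>2 + 2 * Re (r (y n vac) (y n vac))) \<longlonglongrightarrow> 0"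
      using tendsto_add[OF tendsto_mult_left[OF tendsto_power[OF e0], of 2 2]
          tendsto_mult_left[OF tendsto_Re[OF r0], of 2]] by simp
    have "Re (r x x) \<le> 2 * (e n)\<^sup>2 + 2 * Re (r (y n vac) (y n vac))" for n
    proof -
      have d: "a - y n \<in> disk_algebra" by (intro disk_algebra_diff a y)
      have "Re (r ((a - y n) vac + y n vac) ((a - y n) vac + y n vac))
          \<le> 2 * Re (r ((a - y n) vac) ((a - y n) vac)) + 2 * Re (r (y n vac) (y n vac))"
        by (intro psd_form_parallelogram[OF psd] leD d y)
      moreover have "Re (r ((a - y n) vac) ((a - y n) vac)) \<le> (e n)\<^sup>2"
        using leD(2)[OF d] power_mono[of "snorm (a - y n)" "e n" 2] y(3)[of n] snorm_nonneg[OF d]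
        by linarith
      ultimately show ?thesis by (simp add: xa blinfun.diff_left)
    qed
    then show "\<exists>N. \<forall>n\<ge>N. Re (r x x) \<le> 2 * (e n)\<^sup>2 + 2 * Re (r (y n vac) (y n vac))" by blast
  qed
  then show "r x x = 0"
    using psd_formD(7)[OF psd, of x] leD(1)[OF a]
    by (auto simp: xa complex_nonneg_Reals_iff complex_eq_iff)
qed

text \<open>
  If \<open>v\<close> is bounded by the \<open>\<mu>\<close>-seminorm as a functional, a multiple of the rank-one form
  of \<open>v\<close> lies below the form of \<open>\<mu>\<close>; being bounded, it is closable.
\<close>
lemma singular_imp_dominated_vector_zero:
  assumes sing: "nc_singular \<mu>"
    and le: "\<And>a. a \<in> disk_algebra \<Longrightarrow> cmod (cinner v (a vac)) \<le> B * snorm a"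
    and B: "0 < B"
  shows "v = 0"
proof -
  define r :: "'d list ell2 \<Rightarrow> 'd list ell2 \<Rightarrow> complex"
    where "r x y = of_real (1 / B\<^sup>2) * (cnj (cinner v x) * cinner v y)" for x y
  have diag: "r x x = of_real ((cmod (cinner v x))\<^sup>2 / B\<^sup>2)" for x
    unfolding r_def by (simp add: mult.commute flip: complex_norm_square)
  have "psd_form (UNIV, r)"
    unfolding psd_form_def prod.case
  proof (intro conjI ballI allI)
    show "r x x \<in> \<real>\<^sub>\<ge>\<^sub>0" for x
      unfolding diag by (simp add: complex_nonneg_Reals_iff del: of_real_power of_real_divide)
  qed (auto simp: r_def cinner_add_right cinner_scaleC_right algebra_simps)
  moreover have "closable_form (UNIV, r)"
    unfolding closable_form_def prod.case
  proof (intro allI impI, elim conjE)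
    fix x :: "nat \<Rightarrow> 'd list ell2" assume x: "x \<longlonglongrightarrow> 0"
    have "(\<lambda>n. r (x n) (x n)) \<longlonglongrightarrow> r 0 0"
      unfolding r_def by (intro tendsto_intros x)
    then show "(\<lambda>n. r (x n) (x n)) \<longlonglongrightarrow> 0" by (simp add: r_def)
  qed
  moreover have "form_le (UNIV, r) (nc_form \<mu>)"
    unfolding form_le_def nc_form_def prod.case
  proof (intro conjI ballI)
    fix h :: "'d list ell2" assume "h \<in> disk_vecs"
    then obtain a where a: "a \<in> disk_algebra" and h: "h = a vac" unfolding disk_vecs_def by blast
    have "(cmod (cinner v h))\<^sup>2 \<le> (B * snorm a)\<^sup>2" unfolding h by (intro power_mono le a) simp
    then have "(cmod (cinner v h))\<^sup>2 / B\<^sup>2 \<le> (snorm a)\<^sup>2"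
      using B by (simp add: pos_divide_le_eq power_mult_distrib mult.commute)
    then show "Re (r h h) \<le> Re (form (vec_op h) (vec_op h))"
      unfolding diag by (simp add: h vec_op_vac a form_self del: of_real_power of_real_divide)
  qed simp
  ultimately have "\<forall>x\<in>disk_vecs. r x x = 0" using sing unfolding nc_singular_iff by blast
  then have "cinner (ell2_basis w) v = 0" for w
    using B disk_vecs_basis[of w] cinner_cnj[of "ell2_basis w" v] by (auto simp: diag)
  then show "v = 0"
    by (intro ell2_coeff_inject[THEN iffD1] ext) (simp add: cinner_basis zero_ell2.rep_eq)
qed

text \<open>
  Minimize \<open>\<lambda>y. (snorm (a - y))\<^sup>2 + (norm (y vac))\<^sup>2\<close>. By the parallelogram identity a minimizing sequence
  \<open>y\<close> is Cauchy for \<open>\<nu>\<close>, and by the variational condition the limit \<open>v\<close> of its vectors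
  satisfies \<open>cinner (x vac) v = lim (form x (a - y n))\<close>. Hence \<open>v\<close> is dominated by the seminorm and
  vanishes; then the form against \<open>a - y n\<close> tends to zero pointwise, so \<open>a - y n\<close>, being Cauchy,
  tends to zero in seminorm.
\<close>
lemma vanishing_approximation_if_singular:
  assumes sing: "nc_singular \<mu>"
  shows vanishing_approximation
  unfolding vanishing_approximation_def
proof (intro ballI allI impI)
  fix a :: "'d list op" and e :: real
  assume a: "a \<in> disk_algebra" and e: "0 < e"
  define F where "F y = (snorm (a - y))\<^sup>2 + (norm (y vac))\<^sup>2" for y :: "'d list op"
  define \<delta> where "\<delta> = Inf (F ` disk_algebra)"
  have bdd: "bdd_below (F ` disk_algebra)"
    by (rule bdd_belowI2[of _ 0]) (simp add: F_def)
  have \<delta>_le: "\<delta> \<le> F y" if "y \<in> disk_algebra" for y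
    unfolding \<delta>_def by (rule cINF_lower[OF bdd that])
  have "0 \<le> \<delta>"
    unfolding \<delta>_def by (rule cINF_greatest) (use disk_algebra_zero in \<open>auto simp: F_def\<close>)
  define t :: "nat \<Rightarrow> real" where "t n = inverse (real (Suc n))" for n
  have t: "0 < t n" "t n \<le> 1" for n by (simp_all add: t_def field_simps)
  have t0: "t \<longlonglongrightarrow> 0" unfolding t_def by (rule LIMSEQ_inverse_real_of_nat)
  have "\<exists>y\<in>disk_algebra. F y < \<delta> + t n" for n
    using cINF_less_iff[OF _ bdd, of "\<delta> + t n"] t(1)[of n] disk_algebra_zero
    unfolding \<delta>_def by auto
  then obtain y where y: "\<And>n. y n \<in> disk_algebra" "\<And>n. F (y n) < \<delta> + t n" by metis
  have ay: "a - y n \<in> disk_algebra" for n by (intro disk_algebra_diff a y)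

  have variation: "F (z + w) = F z + 2 * Re (cinner (w vac) (z vac) - form w (a - z)) + (sum.snorm w)\<^sup>2"
    if z: "z \<in> disk_algebra" and w: "w \<in> disk_algebra" for z w
  proof -
    have az: "a - z \<in> disk_algebra" by (intro disk_algebra_diff a z)
    have "(snorm (a - (z + w)))\<^sup>2 = (snorm (- w + (a - z)))\<^sup>2" by (simp add: algebra_simps)
    also have "\<dots> = (snorm w)\<^sup>2 - 2 * Re (form w (a - z)) + (snorm (a - z))\<^sup>2"
      unfolding snorm_add_power2[OF disk_algebra_uminus[OF w] az]
      by (simp add: snorm_uminus form_uminus_left az w)
    finally have 1: "(snorm (a - (z + w)))\<^sup>2 = (snorm w)\<^sup>2 - 2 * Re (form w (a - z)) + (snorm (a - z))\<^sup>2" .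
    have "(norm ((z + w) vac))\<^sup>2 = (norm (z vac))\<^sup>2 + 2 * Re (cinner (w vac) (z vac)) + (norm (w vac))\<^sup>2"
      by (simp add: power2_norm_eq_inner blinfun.add_left inner_add_left inner_add_right
          inner_ell2_def[symmetric] inner_commute)
    with 1 show ?thesis by (simp add: F_def sum_snorm_power2 w)
  qed
  have "y \<in> gns_cauchy \<nu>"
  proof (rule sum.gns_cauchyI)
    fix s :: real assume s: "0 < s"
    have s4: "0 < s\<^sup>2 / 4" using s by simp
    obtain N where N: "\<And>n. n \<ge> N \<Longrightarrow> t n < s\<^sup>2 / 4"
      using tendsto_zero_eventually_less[OF t0 s4] by blast
    have "sum.snorm (y n - y k) < s" if "n \<ge> N" "k \<ge> N" for n k
    proof -
      \<comment> \<open>The midpoint and half the difference: the value at the midpoint is at least the infimum.\<close>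
      define m w where "m = (1/2) *\<^sub>R (y n + y k)" and "w = (1/2) *\<^sub>R (y n - y k)"
      have m: "m \<in> disk_algebra" and w: "w \<in> disk_algebra"
        unfolding m_def w_def by (intro disk_algebra_scaleR disk_algebra_add disk_algebra_diff y)+
      have mw: "m + w = y n" "m + - w = y k"
        unfolding m_def w_def by (simp_all add: algebra_simps flip: scaleR_add_left)
      have "F (y n) + F (y k) = 2 * F m + 2 * (sum.snorm w)\<^sup>2"
        using variation[OF m w] variation[OF m disk_algebra_uminus[OF w]]
        unfolding mw
        by (simp add: sum.snorm_uminus w form_uminus_left disk_algebra_diff a m blinfun.minus_left
            cinner_minus_left)
      moreover have "sum.snorm w = sum.snorm (y n - y k) / 2"
        unfolding w_def by (simp add: sum.snorm_scaleR disk_algebra_diff y)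
      ultimately have "(sum.snorm (y n - y k))\<^sup>2 = 2 * (F (y n) + F (y k) - 2 * F m)"
        by (simp add: power_divide)
      also have "\<dots> < s\<^sup>2"
        using \<delta>_le[OF m] y(2)[of n] y(2)[of k] N[OF that(1)] N[OF that(2)] by simp
      finally show ?thesis using s by (simp add: power_less_imp_less_base)
    qed
    then show "\<exists>N. \<forall>n\<ge>N. \<forall>k\<ge>N. sum.snorm (y n - y k) < s" by blast
  qed (rule y)
  note cauchy = sum_cauchy_imp_cauchy[OF this]
  obtain v where v: "(\<lambda>n. y n vac) \<longlonglongrightarrow> v"
    using sum_cauchy_imp_convergent[OF \<open>y \<in> gns_cauchy \<nu>\<close>] by (auto simp: convergent_def)

  have orth: "(\<lambda>n. form x (a - y n)) \<longlonglongrightarrow> cinner (x vac) v" if x: "x \<in> disk_algebra" for x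
  proof -
    define \<beta> where "\<beta> n = cinner (x vac) (y n vac) - form x (a - y n)" for n
    define K where "K = (sum.snorm x)\<^sup>2 + 1"
    have K: "0 < K" by (simp add: K_def add_nonneg_pos)
    have bound: "(cmod (\<beta> n))\<^sup>2 \<le> K * t n" for n
    proof -
      \<comment> \<open>Moving \<open>y n\<close> by \<open>c * x\<close> lowers the value by \<open>(cmod (\<beta> n))\<^sup>2 / K\<close> at least, but \<open>y n\<close> is
        minimizing up to \<open>t n\<close>. The summand 1 in \<open>K\<close> admits an \<open>x\<close> of seminorm zero.\<close>
      define c where "c = - of_real (1 / K) * \<beta> n"
      have cx: "op_scaleC c x \<in> disk_algebra" by (rule disk_algebra_scale[OF x])
      have "\<delta> \<le> F (y n + op_scaleC c x)" by (intro \<delta>_le disk_algebra_add y cx)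
      also have "\<dots> = F (y n) + 2 * Re (cnj c * \<beta> n) + (cmod c)\<^sup>2 * (sum.snorm x)\<^sup>2"
        by (simp add: variation[OF y(1) cx] \<beta>_def form_scale_left x ay op_scaleC_apply
            cinner_scaleC_left sum.snorm_scale power_mult_distrib flip: right_diff_distrib)
      also have "Re (cnj c * \<beta> n) = - ((cmod (\<beta> n))\<^sup>2 / K)"
        unfolding cmod_power2 by (simp add: c_def power2_eq_square add_divide_distrib)
      also have "(cmod c)\<^sup>2 * (sum.snorm x)\<^sup>2 \<le> (cmod c)\<^sup>2 * K"
        by (intro mult_left_mono) (simp_all add: K_def)
      also have "(cmod c)\<^sup>2 * K = (cmod (\<beta> n))\<^sup>2 / K"
        using K by (simp add: c_def norm_mult norm_divide power_mult_distrib power2_eq_square)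
      finally have "(cmod (\<beta> n))\<^sup>2 / K \<le> t n" using y(2)[of n] by simp
      then show ?thesis using K by (simp add: pos_divide_le_eq mult.commute)
    qed
    have "(\<lambda>n. (cmod (\<beta> n))\<^sup>2) \<longlonglongrightarrow> 0"
      by (rule tendsto_sandwich[OF _ _ tendsto_const tendsto_mult_right_zero[OF t0, of K]])
         (use bound in auto)
    from tendsto_real_sqrt[OF this] have "\<beta> \<longlonglongrightarrow> 0" by (simp add: tendsto_norm_zero_iff)
    with tendsto_cinner[OF tendsto_const v, of "x vac"]
    have "(\<lambda>n. cinner (x vac) (y n vac) - \<beta> n) \<longlonglongrightarrow> cinner (x vac) v - 0" by (rule tendsto_diff)
    then show ?thesis by (simp add: \<beta>_def)
  qed
  define B where "B = sqrt (\<delta> + 1)"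
  have B: "0 < B" using \<open>0 \<le> \<delta>\<close> by (simp add: B_def)
  have ayB: "snorm (a - y n) \<le> B" for n
  proof (rule power2_le_imp_le)
    show "(snorm (a - y n))\<^sup>2 \<le> B\<^sup>2"
    proof -
      have "B\<^sup>2 = \<delta> + 1" using \<open>0 \<le> \<delta>\<close> by (simp add: B_def)
      then show ?thesis
        using y(2)[of n] t(2)[of n] zero_le_power2[of "norm (y n vac)"]
        unfolding F_def by linarith
    qed
  qed (use B in simp)
  have "v = 0"
  proof (rule singular_imp_dominated_vector_zero[OF sing _ B])
    fix x :: "'d list op" assume x: "x \<in> disk_algebra"
    have "cmod (cinner (x vac) v) \<le> B * snorm x"
    proof (rule LIMSEQ_le_const2[OF tendsto_norm[OF orth[OF x]]])
      have "cmod (form x (a - y n)) \<le> B * snorm x" for n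
        using form_norm_le[OF x ay, of n] mult_left_mono[OF ayB snorm_nonneg[OF x], of n]
        by (simp add: mult.commute)
      then show "\<exists>N. \<forall>n\<ge>N. norm (form x (a - y n)) \<le> B * snorm x" by blast
    qed
    then show "cmod (cinner v (x vac)) \<le> B * snorm x"
      by (subst cinner_cnj) simp
  qed
  have "(\<lambda>n. snorm (a - y n)) \<longlonglongrightarrow> 0"
  proof (rule LIMSEQ_I)
    fix s :: real assume s: "0 < s"
    define c where "c = s\<^sup>2 / 2"
    have c: "0 < c" using s by (simp add: c_def)
    from c B have cB: "0 < c / B" by simp
    obtain N where N: "\<And>n k. n \<ge> N \<Longrightarrow> k \<ge> N \<Longrightarrow> snorm (y n - y k) < c / B"
      using gns_cauchyE[OF cauchy cB] by blast
    have "(\<lambda>n. cmod (form (a - y N) (a - y n))) \<longlonglongrightarrow> 0"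
      using orth[OF ay[of N]] by (simp add: \<open>v = 0\<close> tendsto_norm_zero)
    from tendsto_zero_eventually_less[OF this c] obtain M
      where M: "\<And>n. n \<ge> M \<Longrightarrow> cmod (form (a - y N) (a - y n)) < c" by blast
    have "snorm (a - y n) < s" if n: "n \<ge> max M N" for n
    proof -
      have d: "y N - y n \<in> disk_algebra" by (intro disk_algebra_diff y)
      have "form (a - y n) (a - y n) = form (y N - y n) (a - y n) + form (a - y N) (a - y n)"
        using form_add_left[OF d ay ay, of N n] by simp
      moreover have "(snorm (a - y n))\<^sup>2 = cmod (form (a - y n) (a - y n))"
        by (simp add: form_self[OF ay] norm_power)
      ultimately have "(snorm (a - y n))\<^sup>2 =
          cmod (form (y N - y n) (a - y n) + form (a - y N) (a - y n))" by simp
      also have "\<dots> \<le> cmod (form (y N - y n) (a - y n)) + cmod (form (a - y N) (a - y n))"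
        by (rule norm_triangle_ineq)
      also have "cmod (form (y N - y n) (a - y n)) \<le> c"
      proof -
        have "cmod (form (y N - y n) (a - y n)) \<le> snorm (y N - y n) * snorm (a - y n)"
          by (rule form_norm_le[OF d ay])
        also have "\<dots> \<le> (c / B) * B"
          by (intro mult_mono ayB snorm_nonneg ay less_imp_le[OF N])
             (use n c B in auto)
        finally show ?thesis using B by simp
      qed
      also have "cmod (form (a - y N) (a - y n)) < c" using M n by simp
      finally have "(snorm (a - y n))\<^sup>2 < s\<^sup>2" by (simp add: c_def)
      then show ?thesis using s by (simp add: power_less_imp_less_base)
    qed
    then show "\<exists>N. \<forall>n\<ge>N. norm (snorm (a - y n) - 0) < s"
      using snorm_nonneg[OF ay] by (intro exI[of _ "max M N"]) auto
  qed
  from tendsto_zero_eventually_less[OF this e] obtain N1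
    where N1: "\<And>n. n \<ge> N1 \<Longrightarrow> snorm (a - y n) < e" by blast
  from v have "(\<lambda>n. norm (y n vac)) \<longlonglongrightarrow> 0" by (simp add: \<open>v = 0\<close> tendsto_norm_zero)
  from tendsto_zero_eventually_less[OF this e] obtain N2
    where N2: "\<And>n. n \<ge> N2 \<Longrightarrow> norm (y n vac) < e" by blast
  show "\<exists>y\<in>disk_algebra. norm ((y :: 'd list op) vac) < e \<and> snorm (a - y) < e"
    by (rule bexI[of _ "y (max N1 N2)"]) (simp_all add: N1 N2 y)
qed

end

theorem corollary5p5:
  fixes \<mu> :: "'d::finite list op \<Rightarrow> complex"
  assumes "nc_measure \<mu>"
  shows "nc_singular \<mu> \<longleftrightarrow>
    (\<exists>V. gns_canonical_isometry \<mu> V \<and>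
      V ` gns_space (\<lambda>a. \<mu> a + nc_lebesgue a) = gns_space \<mu> \<times> UNIV)"
proof -
  interpret positive_nc_measure \<mu> by unfold_locales (rule assms)
  show ?thesis
    using vanishing_approximation_if_singular canonical_map_onto
      gns_canonical_isometry_canonical_map vanishing_approximation_if_onto
      singular_if_vanishing_approximation by blast
qed

end
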